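(* Let $P^*\colon\mathcal B\to\mathcal C$ and $P_*\colon\mathcal C\to\mathcal B$ be functors with $P^*$ left adjoint to $P_*$, let $\mathsf T$ be the associated comonad on $\mathcal C$, let $\eta\colon\mathrm{Id}_{\mathcal B}\to P_*P^*$ be the unit of the adjunction, and let $\Phi\colon\mathcal B\to\mathcal C_{\mathsf T}$ be the comparison functor. (1) If the categories $\mathcal B$ and $\mathcal C$ are abelian, then $\Phi$ is fully faithful if and only if $\eta_H\colon H\to P_*P^*H$ is injective for every object $H$ of $\mathcal B$. Suppose, moreover, that the functor $P^*$ is exact. Then the following are equivalent: $\Phi$ is fully faithful; $\Phi$ is an equivalence; $P^*H\neq0$ for every object $H\ne0$ of $\mathcal B$. (2) If the categories $\mathcal B$ and $\mathcal C$ are triangulated, then $\Phi$ is fully faithful if and only if $\eta_H\colon H\to P_*P^*H$ is a split embedding for every object $H$ of $\mathcal B$.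
   Context: A split embedding is a morphism having a left inverse. The comonad associated with the adjoint pair is $\mathsf T=(T,\varepsilon,\delta)$ with $T=P^*P_*$, $\varepsilon\colon P^*P_*\to\mathrm{Id}_{\mathcal C}$ the counit, and $\delta=P^*\eta P_*\colon T\to TT$. $\mathcal C_{\mathsf T}$ is the category of $\mathsf T$-comodules: objects are pairs $(F,h)$, $F\in\mathcal C$, $h\colon F\to TF$ with $\varepsilon_F\circ h=\mathrm{Id}_F$ and $Th\circ h=\delta_F\circ h$; morphisms $(F_1,h_1)\to(F_2,h_2)$ are morphisms $f\colon F_1\to F_2$ in $\mathcal C$ with $Tf\circ h_1=h_2\circ f$. The comparison functor is $\Phi(H)=(P^*H,\ P^*\eta_H\colon P^*H\to P^*P_*P^*H)$, $\Phi(f)=P^*f$. *)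

theory Defs
  imports "HOL-Algebra.Group"
begin

section \<open>Categories and functors\<close>

text \<open>
  The objects and arrows of a category form carrier sets inside two types. Every arrow has one
  domain and one codomain, so distinct hom-sets are disjoint. The values of the operations outside
  the carriers are irrelevant.
\<close>

record ('o, 'm) category =
  Obj :: "'o set"
  Arr :: "'m set"
  Dom :: "'m \<Rightarrow> 'o"
  Cod :: "'m \<Rightarrow> 'o"
  Ident :: "'o \<Rightarrow> 'm"
  Comp :: "'m \<Rightarrow> 'm \<Rightarrow> 'm"  (infixr \<open>\<cdot>\<index>\<close> 70)

definition Hom :: "('o, 'm) category \<Rightarrow> 'o \<Rightarrow> 'o \<Rightarrow> 'm set" where
  "Hom C X Y = {f \<in> Arr C. Dom C f = X \<and> Cod C f = Y}"

locale category =
  fixes C :: "('o, 'm) category"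
  assumes Dom_in: "f \<in> Arr C \<Longrightarrow> Dom C f \<in> Obj C"
    and Cod_in: "f \<in> Arr C \<Longrightarrow> Cod C f \<in> Obj C"
    and Ident_in: "X \<in> Obj C \<Longrightarrow> Ident C X \<in> Hom C X X"
    and Comp_in: "f \<in> Hom C X Y \<Longrightarrow> g \<in> Hom C Y Z \<Longrightarrow> g \<cdot>\<^bsub>C\<^esub> f \<in> Hom C X Z"
    and Comp_Ident: "f \<in> Hom C X Y \<Longrightarrow> f \<cdot>\<^bsub>C\<^esub> Ident C X = f"
    and Ident_Comp: "f \<in> Hom C X Y \<Longrightarrow> Ident C Y \<cdot>\<^bsub>C\<^esub> f = f"
    and Comp_assoc: "f \<in> Hom C W X \<Longrightarrow> g \<in> Hom C X Y \<Longrightarrow> h \<in> Hom C Y Z \<Longrightarrow>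
      (h \<cdot>\<^bsub>C\<^esub> g) \<cdot>\<^bsub>C\<^esub> f = h \<cdot>\<^bsub>C\<^esub> (g \<cdot>\<^bsub>C\<^esub> f)"

definition monomorphism :: "('o, 'm) category \<Rightarrow> 'm \<Rightarrow> bool" where
  "monomorphism C f \<longleftrightarrow> f \<in> Arr C \<and>
     (\<forall>W. \<forall>g \<in> Hom C W (Dom C f). \<forall>h \<in> Hom C W (Dom C f).
        f \<cdot>\<^bsub>C\<^esub> g = f \<cdot>\<^bsub>C\<^esub> h \<longrightarrow> g = h)"

definition epimorphism :: "('o, 'm) category \<Rightarrow> 'm \<Rightarrow> bool" where
  "epimorphism C f \<longleftrightarrow> f \<in> Arr C \<and>
     (\<forall>Z. \<forall>g \<in> Hom C (Cod C f) Z. \<forall>h \<in> Hom C (Cod C f) Z.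
        g \<cdot>\<^bsub>C\<^esub> f = h \<cdot>\<^bsub>C\<^esub> f \<longrightarrow> g = h)"

definition isomorphism :: "('o, 'm) category \<Rightarrow> 'm \<Rightarrow> bool" where
  "isomorphism C f \<longleftrightarrow> f \<in> Arr C \<and>
     (\<exists>g \<in> Hom C (Cod C f) (Dom C f).
        g \<cdot>\<^bsub>C\<^esub> f = Ident C (Dom C f) \<and> f \<cdot>\<^bsub>C\<^esub> g = Ident C (Cod C f))"

definition split_embedding :: "('o, 'm) category \<Rightarrow> 'm \<Rightarrow> bool" where
  "split_embedding C f \<longleftrightarrow> f \<in> Arr C \<and>
     (\<exists>r \<in> Hom C (Cod C f) (Dom C f). r \<cdot>\<^bsub>C\<^esub> f = Ident C (Dom C f))"

definition zero_object :: "('o, 'm) category \<Rightarrow> 'o \<Rightarrow> bool" where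
  "zero_object C Z \<longleftrightarrow> Z \<in> Obj C \<and>
     (\<forall>X \<in> Obj C. (\<exists>!f. f \<in> Hom C Z X) \<and> (\<exists>!f. f \<in> Hom C X Z))"

record ('o, 'm, 'p, 'n) cfunctor =
  OMap :: "'o \<Rightarrow> 'p"
  AMap :: "'m \<Rightarrow> 'n"

locale cfunctor = A: category A + B: category B
  for A :: "('o, 'm) category" and B :: "('p, 'n) category" +
  fixes F :: "('o, 'm, 'p, 'n) cfunctor"
  assumes OMap_in: "X \<in> Obj A \<Longrightarrow> OMap F X \<in> Obj B"
    and AMap_in: "f \<in> Hom A X Y \<Longrightarrow> AMap F f \<in> Hom B (OMap F X) (OMap F Y)"
    and AMap_Ident: "X \<in> Obj A \<Longrightarrow> AMap F (Ident A X) = Ident B (OMap F X)"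
    and AMap_Comp: "f \<in> Hom A X Y \<Longrightarrow> g \<in> Hom A Y Z \<Longrightarrow>
      AMap F (g \<cdot>\<^bsub>A\<^esub> f) = AMap F g \<cdot>\<^bsub>B\<^esub> AMap F f"

definition id_functor :: "('o, 'm, 'o, 'm) cfunctor" where
  "id_functor = \<lparr>OMap = \<lambda>X. X, AMap = \<lambda>f. f\<rparr>"

definition comp_functor ::
    "('p, 'n, 'r, 'k) cfunctor \<Rightarrow> ('o, 'm, 'p, 'n) cfunctor \<Rightarrow> ('o, 'm, 'r, 'k) cfunctor"
    (infixr \<open>\<circ>\<^sub>F\<close> 55) where
  "G \<circ>\<^sub>F F = \<lparr>OMap = \<lambda>X. OMap G (OMap F X), AMap = \<lambda>f. AMap G (AMap F f)\<rparr>"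

locale nat_trans = F: cfunctor A B F + G: cfunctor A B G
  for A :: "('o, 'm) category" and B :: "('p, 'n) category" and F G +
  fixes t :: "'o \<Rightarrow> 'n"
  assumes component_in: "X \<in> Obj A \<Longrightarrow> t X \<in> Hom B (OMap F X) (OMap G X)"
    and naturality: "f \<in> Hom A X Y \<Longrightarrow> t Y \<cdot>\<^bsub>B\<^esub> AMap F f = AMap G f \<cdot>\<^bsub>B\<^esub> t X"

definition naturally_isomorphic ::
    "('o, 'm) category \<Rightarrow> ('p, 'n) category \<Rightarrow>
     ('o, 'm, 'p, 'n) cfunctor \<Rightarrow> ('o, 'm, 'p, 'n) cfunctor \<Rightarrow> bool" where
  "naturally_isomorphic A B F G \<longleftrightarrow>
     (\<exists>t. nat_trans A B F G t \<and> (\<forall>X \<in> Obj A. isomorphism B (t X)))"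

definition fully_faithful ::
    "('o, 'm) category \<Rightarrow> ('p, 'n) category \<Rightarrow> ('o, 'm, 'p, 'n) cfunctor \<Rightarrow> bool" where
  "fully_faithful A B F \<longleftrightarrow> cfunctor A B F \<and>
     (\<forall>X \<in> Obj A. \<forall>Y \<in> Obj A.
        bij_betw (AMap F) (Hom A X Y) (Hom B (OMap F X) (OMap F Y)))"

definition equivalence_of_categories ::
    "('o, 'm) category \<Rightarrow> ('p, 'n) category \<Rightarrow> ('o, 'm, 'p, 'n) cfunctor \<Rightarrow> bool" where
  "equivalence_of_categories A B F \<longleftrightarrow> cfunctor A B F \<and>
     (\<exists>G. cfunctor B A G \<and>
        naturally_isomorphic A A id_functor (G \<circ>\<^sub>F F) \<and>
        naturally_isomorphic B B (F \<circ>\<^sub>F G) id_functor)"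

section \<open>Adjunctions, comonads, and the comparison functor\<close>

locale adjunction =
  B: category B + C: category C + P: cfunctor B C P + Q: cfunctor C B Q +
  unit: nat_trans B B id_functor "Q \<circ>\<^sub>F P" \<eta> + counit: nat_trans C C "P \<circ>\<^sub>F Q" id_functor \<epsilon>
  for B :: "('b, 'p) category" and C :: "('c, 'q) category"
    and P :: "('b, 'p, 'c, 'q) cfunctor" and Q :: "('c, 'q, 'b, 'p) cfunctor" and \<eta> \<epsilon> +
  assumes triangle_left:
      "H \<in> Obj B \<Longrightarrow> \<epsilon> (OMap P H) \<cdot>\<^bsub>C\<^esub> AMap P (\<eta> H) = Ident C (OMap P H)"
    and triangle_right:
      "F \<in> Obj C \<Longrightarrow> AMap Q (\<epsilon> F) \<cdot>\<^bsub>B\<^esub> \<eta> (OMap Q F) = Ident B (OMap Q F)"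

record ('o, 'm) comonad =
  Endo :: "('o, 'm, 'o, 'm) cfunctor"
  Counit :: "'o \<Rightarrow> 'm"
  Comult :: "'o \<Rightarrow> 'm"

locale comonad =
  nat_trans C C "Endo T" id_functor "Counit T" +
  Comult: nat_trans C C "Endo T" "Endo T \<circ>\<^sub>F Endo T" "Comult T"
  for C :: "('c, 'q) category" and T :: "('c, 'q) comonad" +
  assumes counit_left:
      "X \<in> Obj C \<Longrightarrow> Counit T (OMap (Endo T) X) \<cdot>\<^bsub>C\<^esub> Comult T X = Ident C (OMap (Endo T) X)"
    and counit_right:
      "X \<in> Obj C \<Longrightarrow>
        AMap (Endo T) (Counit T X) \<cdot>\<^bsub>C\<^esub> Comult T X = Ident C (OMap (Endo T) X)"
    and coassoc:
      "X \<in> Obj C \<Longrightarrow>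
        Comult T (OMap (Endo T) X) \<cdot>\<^bsub>C\<^esub> Comult T X
          = AMap (Endo T) (Comult T X) \<cdot>\<^bsub>C\<^esub> Comult T X"

definition adjunction_comonad ::
    "('b, 'p, 'c, 'q) cfunctor \<Rightarrow> ('c, 'q, 'b, 'p) cfunctor \<Rightarrow> ('b \<Rightarrow> 'p) \<Rightarrow> ('c \<Rightarrow> 'q) \<Rightarrow>
     ('c, 'q) comonad" where
  "adjunction_comonad P Q \<eta> \<epsilon> =
     \<lparr>Endo = P \<circ>\<^sub>F Q, Counit = \<epsilon>, Comult = \<lambda>F. AMap P (\<eta> (OMap Q F))\<rparr>"

definition comodules :: "('c, 'q) category \<Rightarrow> ('c, 'q) comonad \<Rightarrow> ('c \<times> 'q) set" where
  "comodules C T = {(F, h). F \<in> Obj C \<and> h \<in> Hom C F (OMap (Endo T) F) \<and>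
     Counit T F \<cdot>\<^bsub>C\<^esub> h = Ident C F \<and>
     AMap (Endo T) h \<cdot>\<^bsub>C\<^esub> h = Comult T F \<cdot>\<^bsub>C\<^esub> h}"

text \<open>
  One arrow of the base category may underlie morphisms between several pairs of comodules, so a
  morphism of comodules is stored together with its source and target.
\<close>

definition comodule_category ::
    "('c, 'q) category \<Rightarrow> ('c, 'q) comonad \<Rightarrow>
     ('c \<times> 'q, ('c \<times> 'q) \<times> 'q \<times> ('c \<times> 'q)) category" where
  "comodule_category C T =
     \<lparr>Obj = comodules C T,
      Arr = {((F1, h1), f, (F2, h2)) | F1 h1 f F2 h2.
               (F1, h1) \<in> comodules C T \<and> (F2, h2) \<in> comodules C T \<and> f \<in> Hom C F1 F2 \<and>
               AMap (Endo T) f \<cdot>\<^bsub>C\<^esub> h1 = h2 \<cdot>\<^bsub>C\<^esub> f},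
      Dom = (\<lambda>(x, f, y). x),
      Cod = (\<lambda>(x, f, y). y),
      Ident = (\<lambda>(F, h). ((F, h), Ident C F, (F, h))),
      Comp = (\<lambda>(y, g, z) (x, f, y'). (x, g \<cdot>\<^bsub>C\<^esub> f, z))\<rparr>"

definition comparison_functor ::
    "('b, 'p) category \<Rightarrow> ('b, 'p, 'c, 'q) cfunctor \<Rightarrow> ('b \<Rightarrow> 'p) \<Rightarrow>
     ('b, 'p, 'c \<times> 'q, ('c \<times> 'q) \<times> 'q \<times> ('c \<times> 'q)) cfunctor" where
  "comparison_functor B P \<eta> =
     (let \<Phi> = (\<lambda>H. (OMap P H, AMap P (\<eta> H)))
      in \<lparr>OMap = \<Phi>, AMap = \<lambda>f. (\<Phi> (Dom B f), AMap P f, \<Phi> (Cod B f))\<rparr>)"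

section \<open>The comonad of an adjunction and its comparison functor are well defined\<close>

context adjunction
begin

lemma AMap_P_Comp: "f \<in> Hom B X Y \<Longrightarrow> g \<in> Hom B Y Z \<Longrightarrow> AMap P g \<cdot>\<^bsub>C\<^esub> AMap P f = AMap P (g \<cdot>\<^bsub>B\<^esub> f)"
  using P.AMap_Comp by simp

lemma Hom_B_Obj: "f \<in> Hom B X Y \<Longrightarrow> X \<in> Obj B \<and> Y \<in> Obj B"
  using B.Dom_in B.Cod_in unfolding Hom_def by auto

lemma Hom_C_Obj: "f \<in> Hom C X Y \<Longrightarrow> X \<in> Obj C \<and> Y \<in> Obj C"
  using C.Dom_in C.Cod_in unfolding Hom_def by auto

lemma eta_in: "X \<in> Obj B \<Longrightarrow> \<eta> X \<in> Hom B X (OMap Q (OMap P X))"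
  using unit.component_in[of X] by (simp add: comp_functor_def id_functor_def)

lemma eta_nat: "f \<in> Hom B X Y \<Longrightarrow> \<eta> Y \<cdot>\<^bsub>B\<^esub> f = AMap Q (AMap P f) \<cdot>\<^bsub>B\<^esub> \<eta> X"
  using unit.naturality[of f X Y] by (simp add: comp_functor_def id_functor_def)

lemma eps_in: "X \<in> Obj C \<Longrightarrow> \<epsilon> X \<in> Hom C (OMap P (OMap Q X)) X"
  using counit.component_in[of X] by (simp add: comp_functor_def id_functor_def)

lemma eps_nat: "f \<in> Hom C X Y \<Longrightarrow> \<epsilon> Y \<cdot>\<^bsub>C\<^esub> AMap P (AMap Q f) = f \<cdot>\<^bsub>C\<^esub> \<epsilon> X"
  using counit.naturality[of f X Y] by (simp add: comp_functor_def id_functor_def)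

lemma comodules_iff: "(F,h) \<in> comodules C (adjunction_comonad P Q \<eta> \<epsilon>) \<longleftrightarrow> F \<in> Obj C \<and> h \<in> Hom C F (OMap P (OMap Q F)) \<and>
  \<epsilon> F \<cdot>\<^bsub>C\<^esub> h = Ident C F \<and> AMap P (AMap Q h) \<cdot>\<^bsub>C\<^esub> h = AMap P (\<eta> (OMap Q F)) \<cdot>\<^bsub>C\<^esub> h"
  unfolding comodules_def adjunction_comonad_def comp_functor_def by simp

lemma Hom_comodule_category: "x \<in> Hom (comodule_category C (adjunction_comonad P Q \<eta> \<epsilon>)) (F1,h1) (F2,h2) \<longleftrightarrow>
   (\<exists>f. x = ((F1,h1),f,(F2,h2)) \<and> (F1, h1) \<in> comodules C (adjunction_comonad P Q \<eta> \<epsilon>) \<and> (F2, h2) \<in> comodules C (adjunction_comonad P Q \<eta> \<epsilon>) \<and> f \<in> Hom C F1 F2 \<and>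
               AMap P (AMap Q f) \<cdot>\<^bsub>C\<^esub> h1 = h2 \<cdot>\<^bsub>C\<^esub> f)"
  unfolding Hom_def[of "comodule_category C (adjunction_comonad P Q \<eta> \<epsilon>)"] 
  by (auto simp: comodule_category_def adjunction_comonad_def comp_functor_def)

lemma AMap_PQ_Ident: "X \<in> Obj C \<Longrightarrow> AMap P (AMap Q (Ident C X)) = Ident C (OMap P (OMap Q X))"
  by (simp add: Q.AMap_Ident P.AMap_Ident Q.OMap_in)

lemma category_comodules: "category (comodule_category C (adjunction_comonad P Q \<eta> \<epsilon>))" (is "category ?CT")
proof
  show "f \<in> Arr ?CT \<Longrightarrow> Dom ?CT f \<in> Obj ?CT" for f by (auto simp: comodule_category_def)
  show "f \<in> Arr ?CT \<Longrightarrow> Cod ?CT f \<in> Obj ?CT" for f by (auto simp: comodule_category_def)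
  show "Ident ?CT X \<in> Hom ?CT X X" if "X \<in> Obj ?CT" for X
  proof (cases X)
    case (Pair F h)
    with that have c: "(F,h) \<in> comodules C (adjunction_comonad P Q \<eta> \<epsilon>)" by (simp add: comodule_category_def)
    then have F: "F \<in> Obj C" and h: "h \<in> Hom C F (OMap P (OMap Q F))" by (auto simp: comodules_iff)
    have "Ident ?CT X = (X, Ident C F, X)" using Pair by (simp add: comodule_category_def)
    then show ?thesis using c F h unfolding Pair Hom_comodule_category
      by (simp add: AMap_PQ_Ident C.Ident_in C.Comp_Ident C.Ident_Comp)
  qed
  show "g \<cdot>\<^bsub>?CT\<^esub> f \<in> Hom ?CT X Z" if f: "f \<in> Hom ?CT X Y" and g: "g \<in> Hom ?CT Y Z" for f g X Y Z
  proof (cases X, cases Y, cases Z)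
    fix F1 h1 F2 h2 F3 h3 assume e: "X = (F1,h1)" "Y = (F2,h2)" "Z = (F3,h3)"
    from f obtain f' where f': "f = (X,f',Y)" "X \<in> comodules C (adjunction_comonad P Q \<eta> \<epsilon>)" "Y \<in> comodules C (adjunction_comonad P Q \<eta> \<epsilon>)" "f' \<in> Hom C F1 F2" 
       "AMap P (AMap Q f') \<cdot>\<^bsub>C\<^esub> h1 = h2 \<cdot>\<^bsub>C\<^esub> f'" unfolding e Hom_comodule_category by auto
    from g obtain g' where g': "g = (Y,g',Z)" "Z \<in> comodules C (adjunction_comonad P Q \<eta> \<epsilon>)" "g' \<in> Hom C F2 F3" 
       "AMap P (AMap Q g') \<cdot>\<^bsub>C\<^esub> h2 = h3 \<cdot>\<^bsub>C\<^esub> g'" unfolding e Hom_comodule_category by auto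
    have h: "h1 \<in> Hom C F1 (OMap P (OMap Q F1))" "h2 \<in> Hom C F2 (OMap P (OMap Q F2))" "h3 \<in> Hom C F3 (OMap P (OMap Q F3))"
      using f' g' by (auto simp: e comodules_iff)
    have T: "AMap P (AMap Q f') \<in> Hom C (OMap P (OMap Q F1)) (OMap P (OMap Q F2))"
            "AMap P (AMap Q g') \<in> Hom C (OMap P (OMap Q F2)) (OMap P (OMap Q F3))"
       using f'(4) g'(3) P.AMap_in Q.AMap_in by blast+
    have "AMap P (AMap Q (g' \<cdot>\<^bsub>C\<^esub> f')) \<cdot>\<^bsub>C\<^esub> h1 = h3 \<cdot>\<^bsub>C\<^esub> (g' \<cdot>\<^bsub>C\<^esub> f')"
    proof -
      have 1: "AMap P (AMap Q (g' \<cdot>\<^bsub>C\<^esub> f')) = AMap P (AMap Q g') \<cdot>\<^bsub>C\<^esub> AMap P (AMap Q f')"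
        using P.AMap_Comp[OF Q.AMap_in[OF f'(4)] Q.AMap_in[OF g'(3)]] Q.AMap_Comp[OF f'(4) g'(3)] by simp
      show ?thesis unfolding 1 C.Comp_assoc[OF h(1) T] f'(5) C.Comp_assoc[OF f'(4) h(2) T(2), symmetric] g'(4)
         C.Comp_assoc[OF f'(4) g'(3) h(3)] ..
    qed
    moreover have "g \<cdot>\<^bsub>?CT\<^esub> f = (X, g' \<cdot>\<^bsub>C\<^esub> f', Z)" using f' g' by (simp add: comodule_category_def)
    ultimately show ?thesis using f' g' C.Comp_in unfolding e Hom_comodule_category by (auto simp: e)
  qed
  show "f \<cdot>\<^bsub>?CT\<^esub> Ident ?CT X = f" if "f \<in> Hom ?CT X Y" for f X Y
    using that by (cases X, cases Y) (auto simp: Hom_comodule_category, auto simp: comodule_category_def C.Comp_Ident)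
  show "Ident ?CT Y \<cdot>\<^bsub>?CT\<^esub> f = f" if "f \<in> Hom ?CT X Y" for f X Y
    using that by (cases X, cases Y) (auto simp: Hom_comodule_category, auto simp: comodule_category_def C.Ident_Comp)
  show "(h \<cdot>\<^bsub>?CT\<^esub> g) \<cdot>\<^bsub>?CT\<^esub> f = h \<cdot>\<^bsub>?CT\<^esub> (g \<cdot>\<^bsub>?CT\<^esub> f)"
    if "f \<in> Hom ?CT W X" "g \<in> Hom ?CT X Y" "h \<in> Hom ?CT Y Z" for f g h W X Y Z
    using that by (cases W, cases X, cases Y, cases Z) (auto simp: Hom_comodule_category, auto simp: comodule_category_def C.Comp_assoc)
qed

lemma cfunctor_comparison: "cfunctor B (comodule_category C (adjunction_comonad P Q \<eta> \<epsilon>)) (comparison_functor B P \<eta>)"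
proof -
  interpret CT: category "comodule_category C (adjunction_comonad P Q \<eta> \<epsilon>)" by (rule category_comodules)
  have ob: "(OMap P X, AMap P (\<eta> X)) \<in> comodules C (adjunction_comonad P Q \<eta> \<epsilon>)" if "X \<in> Obj B" for X
  proof -
    have e: "\<eta> X \<in> Hom B X (OMap Q (OMap P X))" using eta_in that .
    have e2: "\<eta> (OMap Q (OMap P X)) \<in> Hom B (OMap Q (OMap P X)) (OMap Q (OMap P (OMap Q (OMap P X))))"
      using eta_in P.OMap_in Q.OMap_in that by auto
    have "AMap P (AMap Q (AMap P (\<eta> X))) \<cdot>\<^bsub>C\<^esub> AMap P (\<eta> X) = AMap P (AMap Q (AMap P (\<eta> X)) \<cdot>\<^bsub>B\<^esub> \<eta> X)"
      using e P.AMap_in[OF e] Q.AMap_in AMap_P_Comp by metis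
    also have "\<dots> = AMap P (\<eta> (OMap Q (OMap P X)) \<cdot>\<^bsub>B\<^esub> \<eta> X)" using eta_nat[OF e] by simp
    also have "\<dots> = AMap P (\<eta> (OMap Q (OMap P X))) \<cdot>\<^bsub>C\<^esub> AMap P (\<eta> X)" using AMap_P_Comp[OF e e2] by simp
    finally show ?thesis using that e P.AMap_in[OF e] triangle_left P.OMap_in by (simp add: comodules_iff)
  qed
  show ?thesis
  proof
    show "OMap (comparison_functor B P \<eta>) X \<in> Obj (comodule_category C (adjunction_comonad P Q \<eta> \<epsilon>))" if "X \<in> Obj B" for X
      using ob[OF that] by (simp add: comparison_functor_def comodule_category_def Let_def)
    show "AMap (comparison_functor B P \<eta>) f \<in> Hom (comodule_category C (adjunction_comonad P Q \<eta> \<epsilon>)) (OMap (comparison_functor B P \<eta>) X) (OMap (comparison_functor B P \<eta>) Y)" if f: "f \<in> Hom B X Y" for f X Y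
    proof -
      have d: "Dom B f = X" "Cod B f = Y" using f by (auto simp: Hom_def)
      have XY: "X \<in> Obj B" "Y \<in> Obj B" using Hom_B_Obj f by auto
      have "AMap P (AMap Q (AMap P f)) \<cdot>\<^bsub>C\<^esub> AMap P (\<eta> X) = AMap P (\<eta> Y) \<cdot>\<^bsub>C\<^esub> AMap P f"
        using AMap_P_Comp[OF eta_in[OF XY(1)] Q.AMap_in[OF P.AMap_in[OF f]]] AMap_P_Comp[OF f eta_in[OF XY(2)]] eta_nat[OF f] by simp
      then show ?thesis using d ob XY P.AMap_in[OF f] by (simp add: comparison_functor_def Let_def Hom_comodule_category)
    qed
    show "AMap (comparison_functor B P \<eta>) (Ident B X) = Ident (comodule_category C (adjunction_comonad P Q \<eta> \<epsilon>)) (OMap (comparison_functor B P \<eta>) X)" if "X \<in> Obj B" for X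
      using B.Ident_in[OF that] P.AMap_Ident[OF that] by (simp add: comparison_functor_def comodule_category_def Let_def Hom_def)
    show "AMap (comparison_functor B P \<eta>) (g \<cdot>\<^bsub>B\<^esub> f) = AMap (comparison_functor B P \<eta>) g \<cdot>\<^bsub>comodule_category C (adjunction_comonad P Q \<eta> \<epsilon>)\<^esub> AMap (comparison_functor B P \<eta>) f"
      if "f \<in> Hom B X Y" "g \<in> Hom B Y Z" for f g X Y Z
      using B.Comp_in[OF that] P.AMap_Comp[OF that] that by (simp add: comparison_functor_def comodule_category_def Let_def Hom_def)
  qed
qed

lemma comonad_adjunction_comonad: "comonad C (adjunction_comonad P Q \<eta> \<epsilon>)"
proof -
  have d: "AMap P (\<eta> (OMap Q X)) \<in> Hom C (OMap P (OMap Q X)) (OMap P (OMap Q (OMap P (OMap Q X))))" if "X \<in> Obj C" for X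
    using P.AMap_in[OF eta_in[OF Q.OMap_in[OF that]]] .
  have n: "AMap P (\<eta> (OMap Q Y)) \<cdot>\<^bsub>C\<^esub> AMap P (AMap Q f)
     = AMap P (AMap Q (AMap P (AMap Q f))) \<cdot>\<^bsub>C\<^esub> AMap P (\<eta> (OMap Q X))" if f: "f \<in> Hom C X Y" for f X Y
  proof -
    have q: "AMap Q f \<in> Hom B (OMap Q X) (OMap Q Y)" using Q.AMap_in f .
    have o: "OMap Q X \<in> Obj B" "OMap Q Y \<in> Obj B" using Hom_B_Obj[OF q] by auto
    show ?thesis using AMap_P_Comp[OF q eta_in[OF o(2)]] AMap_P_Comp[OF eta_in[OF o(1)] Q.AMap_in[OF P.AMap_in[OF q]]] eta_nat[OF q] by simp
  qed
  have F: "cfunctor C C ((P \<circ>\<^sub>F Q) \<circ>\<^sub>F (P \<circ>\<^sub>F Q))"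
    by unfold_locales (auto simp: comp_functor_def P.OMap_in Q.OMap_in P.AMap_Ident Q.AMap_Ident P.AMap_in Q.AMap_in, metis P.AMap_in Q.AMap_in P.AMap_Comp Q.AMap_Comp)
  have N: "nat_trans C C (P \<circ>\<^sub>F Q) ((P \<circ>\<^sub>F Q) \<circ>\<^sub>F (P \<circ>\<^sub>F Q)) (\<lambda>F. AMap P (\<eta> (OMap Q F)))"
    using F counit.F.cfunctor_axioms d n unfolding nat_trans_def nat_trans_axioms_def by (simp add: comp_functor_def)
  have c: "AMap P (AMap Q (AMap P (\<eta> (OMap Q X)))) \<cdot>\<^bsub>C\<^esub> AMap P (\<eta> (OMap Q X)) =
     AMap P (\<eta> (OMap Q (OMap P (OMap Q X)))) \<cdot>\<^bsub>C\<^esub> AMap P (\<eta> (OMap Q X))" if X: "X \<in> Obj C" for X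
  proof -
    have q: "OMap Q X \<in> Obj B" using Q.OMap_in X .
    have q2: "OMap Q (OMap P (OMap Q X)) \<in> Obj B" using q P.OMap_in Q.OMap_in by simp
    show ?thesis using AMap_P_Comp[OF eta_in[OF q] Q.AMap_in[OF P.AMap_in[OF eta_in[OF q]]]] AMap_P_Comp[OF eta_in[OF q] eta_in[OF q2]] eta_nat[OF eta_in[OF q]] by simp
  qed
  have r: "AMap P (AMap Q (\<epsilon> X)) \<cdot>\<^bsub>C\<^esub> AMap P (\<eta> (OMap Q X)) = Ident C (OMap P (OMap Q X))" if X: "X \<in> Obj C" for X
    using AMap_P_Comp[OF eta_in[OF Q.OMap_in[OF X]] Q.AMap_in[OF eps_in[OF X]]] triangle_right[OF X] P.AMap_Ident Q.OMap_in X by simp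
  show ?thesis unfolding comonad_def comonad_axioms_def
    using N counit.nat_trans_axioms c r triangle_left Q.OMap_in
    by (simp add: adjunction_comonad_def) (simp add: comp_functor_def)
qed

end

section \<open>Additive and abelian categories\<close>

text \<open>
  An additive structure assigns to objects X and Y an abelian group \<open>A X Y\<close> on the hom-set, written
  multiplicatively following HOL-Algebra: the sum of arrows is \<open>\<otimes>\<close>, the zero arrow is \<open>\<one>\<close>, and the
  negative of an arrow is \<open>inv\<close>.
\<close>

type_synonym ('o, 'm) hom_groups = "'o \<Rightarrow> 'o \<Rightarrow> 'm monoid"

abbreviation zero_arr :: "('o, 'm) hom_groups \<Rightarrow> 'o \<Rightarrow> 'o \<Rightarrow> 'm" where
  "zero_arr A X Y \<equiv> \<one>\<^bsub>A X Y\<^esub>"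

definition is_kernel ::
    "('o, 'm) category \<Rightarrow> ('o, 'm) hom_groups \<Rightarrow> 'm \<Rightarrow> 'm \<Rightarrow> bool" where
  "is_kernel C A k f \<longleftrightarrow> k \<in> Arr C \<and> f \<in> Arr C \<and> Cod C k = Dom C f \<and>
     f \<cdot>\<^bsub>C\<^esub> k = zero_arr A (Dom C k) (Cod C f) \<and>
     (\<forall>W. \<forall>j \<in> Hom C W (Dom C f). f \<cdot>\<^bsub>C\<^esub> j = zero_arr A W (Cod C f) \<longrightarrow>
        (\<exists>!u. u \<in> Hom C W (Dom C k) \<and> k \<cdot>\<^bsub>C\<^esub> u = j))"

definition is_cokernel ::
    "('o, 'm) category \<Rightarrow> ('o, 'm) hom_groups \<Rightarrow> 'm \<Rightarrow> 'm \<Rightarrow> bool" where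
  "is_cokernel C A q f \<longleftrightarrow> q \<in> Arr C \<and> f \<in> Arr C \<and> Dom C q = Cod C f \<and>
     q \<cdot>\<^bsub>C\<^esub> f = zero_arr A (Dom C f) (Cod C q) \<and>
     (\<forall>Z. \<forall>j \<in> Hom C (Cod C f) Z. j \<cdot>\<^bsub>C\<^esub> f = zero_arr A (Dom C f) Z \<longrightarrow>
        (\<exists>!u. u \<in> Hom C (Cod C q) Z \<and> u \<cdot>\<^bsub>C\<^esub> q = j))"

locale additive_category = category C
  for C :: "('o, 'm) category" +
  fixes A :: "('o, 'm) hom_groups"
  assumes hom_group: "X \<in> Obj C \<Longrightarrow> Y \<in> Obj C \<Longrightarrow> comm_group (A X Y)"
    and carrier_hom_group: "X \<in> Obj C \<Longrightarrow> Y \<in> Obj C \<Longrightarrow> carrier (A X Y) = Hom C X Y"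
    and Comp_add_right: "f \<in> Hom C X Y \<Longrightarrow> f' \<in> Hom C X Y \<Longrightarrow> g \<in> Hom C Y Z \<Longrightarrow>
      g \<cdot>\<^bsub>C\<^esub> (f \<otimes>\<^bsub>A X Y\<^esub> f') = (g \<cdot>\<^bsub>C\<^esub> f) \<otimes>\<^bsub>A X Z\<^esub> (g \<cdot>\<^bsub>C\<^esub> f')"
    and Comp_add_left: "f \<in> Hom C X Y \<Longrightarrow> g \<in> Hom C Y Z \<Longrightarrow> g' \<in> Hom C Y Z \<Longrightarrow>
      (g \<otimes>\<^bsub>A Y Z\<^esub> g') \<cdot>\<^bsub>C\<^esub> f = (g \<cdot>\<^bsub>C\<^esub> f) \<otimes>\<^bsub>A X Z\<^esub> (g' \<cdot>\<^bsub>C\<^esub> f)"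
    and zero_object_exists: "\<exists>Z. zero_object C Z"
    and biproduct_exists: "X \<in> Obj C \<Longrightarrow> Y \<in> Obj C \<Longrightarrow>
      \<exists>S \<in> Obj C. \<exists>i \<in> Hom C X S. \<exists>j \<in> Hom C Y S. \<exists>p \<in> Hom C S X. \<exists>q \<in> Hom C S Y.
        p \<cdot>\<^bsub>C\<^esub> i = Ident C X \<and> q \<cdot>\<^bsub>C\<^esub> j = Ident C Y \<and>
        q \<cdot>\<^bsub>C\<^esub> i = zero_arr A X Y \<and> p \<cdot>\<^bsub>C\<^esub> j = zero_arr A Y X \<and>
        (i \<cdot>\<^bsub>C\<^esub> p) \<otimes>\<^bsub>A S S\<^esub> (j \<cdot>\<^bsub>C\<^esub> q) = Ident C S"

locale abelian_category = additive_category +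
  assumes kernel_exists: "f \<in> Arr C \<Longrightarrow> \<exists>k. is_kernel C A k f"
    and cokernel_exists: "f \<in> Arr C \<Longrightarrow> \<exists>q. is_cokernel C A q f"
    and mono_is_kernel: "monomorphism C f \<Longrightarrow> \<exists>g. is_kernel C A f g"
    and epi_is_cokernel: "epimorphism C f \<Longrightarrow> \<exists>g. is_cokernel C A f g"

locale additive_functor = cfunctor B C F
  for B :: "('o, 'm) category" and AB and C :: "('p, 'n) category" and AC
    and F :: "('o, 'm, 'p, 'n) cfunctor" +
  assumes AMap_add: "f \<in> Hom B X Y \<Longrightarrow> g \<in> Hom B X Y \<Longrightarrow>
      AMap F (f \<otimes>\<^bsub>AB X Y\<^esub> g) = AMap F f \<otimes>\<^bsub>AC (OMap F X) (OMap F Y)\<^esub> AMap F g"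

definition short_exact ::
    "('o, 'm) category \<Rightarrow> ('o, 'm) hom_groups \<Rightarrow> 'm \<Rightarrow> 'm \<Rightarrow> bool" where
  "short_exact C A f g \<longleftrightarrow> is_kernel C A f g \<and> is_cokernel C A g f"

locale exact_functor = additive_functor +
  assumes preserves_short_exact:
    "short_exact B AB f g \<Longrightarrow> short_exact C AC (AMap F f) (AMap F g)"

section \<open>Triangulated categories\<close>

record ('o, 'm) triangulation =
  Shift :: "('o, 'm, 'o, 'm) cfunctor"
  Dist :: "('m \<times> 'm \<times> 'm) set"

text \<open>A triangle \<open>X \<longrightarrow> Y \<longrightarrow> Z \<longrightarrow> S X\<close> is given by its three arrows.\<close>

definition triangle ::
    "('o, 'm) category \<Rightarrow> ('o, 'm, 'o, 'm) cfunctor \<Rightarrow> 'm \<times> 'm \<times> 'm \<Rightarrow> bool" where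
  "triangle C S = (\<lambda>(f, g, h). f \<in> Arr C \<and> g \<in> Arr C \<and> h \<in> Arr C \<and>
     Dom C g = Cod C f \<and> Dom C h = Cod C g \<and> Cod C h = OMap S (Dom C f))"

definition triangle_morphism ::
    "('o, 'm) category \<Rightarrow> ('o, 'm, 'o, 'm) cfunctor \<Rightarrow>
     'm \<times> 'm \<times> 'm \<Rightarrow> 'm \<times> 'm \<times> 'm \<Rightarrow> 'm \<Rightarrow> 'm \<Rightarrow> 'm \<Rightarrow> bool" where
  "triangle_morphism C S = (\<lambda>(f, g, h) (f', g', h') a b c.
     a \<in> Hom C (Dom C f) (Dom C f') \<and> b \<in> Hom C (Dom C g) (Dom C g') \<and>
     c \<in> Hom C (Dom C h) (Dom C h') \<and>
     b \<cdot>\<^bsub>C\<^esub> f = f' \<cdot>\<^bsub>C\<^esub> a \<and> c \<cdot>\<^bsub>C\<^esub> g = g' \<cdot>\<^bsub>C\<^esub> b \<and> AMap S a \<cdot>\<^bsub>C\<^esub> h = h' \<cdot>\<^bsub>C\<^esub> c)"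

text \<open>
  In the octahedral axiom the arrows are named as in
  \<open>X \<longrightarrow>f Y \<longrightarrow>f' Z' \<longrightarrow>f'' S X\<close>, \<open>Y \<longrightarrow>g Z \<longrightarrow>g' X' \<longrightarrow>g'' S Y\<close>,
  \<open>X \<longrightarrow>gf Z \<longrightarrow>h' Y' \<longrightarrow>h'' S X\<close>, and the new triangle is \<open>Z' \<longrightarrow>u Y' \<longrightarrow>v X' \<longrightarrow> S Z'\<close>.
\<close>

locale triangulated_category = additive_category C A
  for C :: "('o, 'm) category" and A +
  fixes D :: "('o, 'm) triangulation"
  assumes shift_additive: "additive_functor C A C A (Shift D)"
    and shift_equivalence: "equivalence_of_categories C C (Shift D)"
    and Dist_triangle: "t \<in> Dist D \<Longrightarrow> triangle C (Shift D) t"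
    and Dist_iso_closed:
      "t \<in> Dist D \<Longrightarrow> triangle C (Shift D) t' \<Longrightarrow> triangle_morphism C (Shift D) t t' a b c \<Longrightarrow>
       isomorphism C a \<Longrightarrow> isomorphism C b \<Longrightarrow> isomorphism C c \<Longrightarrow> t' \<in> Dist D"
    and Dist_Ident:
      "X \<in> Obj C \<Longrightarrow> zero_object C Z \<Longrightarrow>
       (Ident C X, zero_arr A X Z, zero_arr A Z (OMap (Shift D) X)) \<in> Dist D"
    and Dist_cone: "f \<in> Arr C \<Longrightarrow> \<exists>g h. (f, g, h) \<in> Dist D"
    and Dist_rotate:
      "triangle C (Shift D) (f, g, h) \<Longrightarrow>
       (f, g, h) \<in> Dist D \<longleftrightarrow>
       (g, h, inv\<^bsub>A (OMap (Shift D) (Dom C f)) (OMap (Shift D) (Cod C f))\<^esub> (AMap (Shift D) f))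
         \<in> Dist D"
    and Dist_fill:
      "(f, g, h) \<in> Dist D \<Longrightarrow> (f', g', h') \<in> Dist D \<Longrightarrow>
       a \<in> Hom C (Dom C f) (Dom C f') \<Longrightarrow> b \<in> Hom C (Cod C f) (Cod C f') \<Longrightarrow>
       b \<cdot>\<^bsub>C\<^esub> f = f' \<cdot>\<^bsub>C\<^esub> a \<Longrightarrow>
       \<exists>c. triangle_morphism C (Shift D) (f, g, h) (f', g', h') a b c"
    and octahedral:
      "(f, f', f'') \<in> Dist D \<Longrightarrow> (g, g', g'') \<in> Dist D \<Longrightarrow> Cod C f = Dom C g \<Longrightarrow>
       (g \<cdot>\<^bsub>C\<^esub> f, h', h'') \<in> Dist D \<Longrightarrow>
       \<exists>u \<in> Hom C (Cod C f') (Cod C h'). \<exists>v \<in> Hom C (Cod C h') (Cod C g').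
         (u, v, AMap (Shift D) f' \<cdot>\<^bsub>C\<^esub> g'') \<in> Dist D \<and>
         u \<cdot>\<^bsub>C\<^esub> f' = h' \<cdot>\<^bsub>C\<^esub> g \<and> h'' \<cdot>\<^bsub>C\<^esub> u = f'' \<and>
         v \<cdot>\<^bsub>C\<^esub> h' = g' \<and> g'' \<cdot>\<^bsub>C\<^esub> v = AMap (Shift D) f \<cdot>\<^bsub>C\<^esub> h''"

end

theory Submission
  imports Defs
begin

text \<open>
  All three criteria come from one fact: if every \<open>\<eta> H\<close> is monic and is the equalizer of some pair
  of arrows \<open>a, b\<close>, then the comparison functor is fully faithful. Indeed a comodule morphism
  \<open>f : (P X, P \<eta>\<^sub>X) \<rightarrow> (P Y, P \<eta>\<^sub>Y)\<close> has the adjunct \<open>k = Q f \<cdot> \<eta>\<^sub>X\<close>, and naturality of the unit gives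
  \<open>\<eta> \<cdot> a \<cdot> k = \<eta> \<cdot> b \<cdot> k\<close>, so \<open>k\<close> factors through \<open>\<eta>\<^sub>Y\<close>. Conversely faithfulness alone makes every
  \<open>\<eta> H\<close> monic. In an abelian category monomorphisms are kernels, and in a triangulated category they
  split; both kinds are equalizers.

  For exact \<open>P\<close>, the arrow \<open>P \<eta>\<^sub>H\<close> is split monic, so \<open>P\<close> kills \<open>ker \<eta>\<^sub>H\<close>, which therefore vanishes when
  \<open>P\<close> kills no nonzero object. A comodule \<open>(F, h)\<close> is the image of the kernel \<open>E\<close> of \<open>Q h - \<eta>\<^sub>Q\<^sub>F\<close>: both
  \<open>P E\<close> and \<open>h : F \<rightarrow> P Q F\<close> are equalizers of \<open>P Q h\<close> and \<open>P \<eta>\<^sub>Q\<^sub>F\<close>, the former by exactness and the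
  latter because the fork is split.
\<close>

section \<open>Regular monomorphisms and equivalences\<close>

context category
begin

text \<open>Typing is phrased through \<open>Arr\<close>, \<open>Dom\<close> and \<open>Cod\<close>
  instead of \<open>Hom\<close>, so that simplification can discharge composability without having
  to guess intermediate objects.\<close>

lemma Ident_Arr [simp]: "X \<in> Obj C \<Longrightarrow> Ident C X \<in> Arr C"
  and Dom_Ident [simp]: "X \<in> Obj C \<Longrightarrow> Dom C (Ident C X) = X"
  and Cod_Ident [simp]: "X \<in> Obj C \<Longrightarrow> Cod C (Ident C X) = X"
  using Ident_in by (auto simp: Hom_def)

lemma Comp_Arr [simp]: "f \<in> Arr C \<Longrightarrow> g \<in> Arr C \<Longrightarrow> Dom C g = Cod C f \<Longrightarrow> g \<cdot>\<^bsub>C\<^esub> f \<in> Arr C"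
  and Dom_Comp [simp]: "f \<in> Arr C \<Longrightarrow> g \<in> Arr C \<Longrightarrow> Dom C g = Cod C f \<Longrightarrow> Dom C (g \<cdot>\<^bsub>C\<^esub> f) = Dom C f"
  and Cod_Comp [simp]: "f \<in> Arr C \<Longrightarrow> g \<in> Arr C \<Longrightarrow> Dom C g = Cod C f \<Longrightarrow> Cod C (g \<cdot>\<^bsub>C\<^esub> f) = Cod C g"
  using Comp_in[of f "Dom C f" "Cod C f" g "Cod C g"] by (auto simp: Hom_def)

lemma Comp_assoc_Arr [simp]:
  "f \<in> Arr C \<Longrightarrow> g \<in> Arr C \<Longrightarrow> h \<in> Arr C \<Longrightarrow> Dom C g = Cod C f \<Longrightarrow> Dom C h = Cod C g \<Longrightarrow>
    (h \<cdot>\<^bsub>C\<^esub> g) \<cdot>\<^bsub>C\<^esub> f = h \<cdot>\<^bsub>C\<^esub> (g \<cdot>\<^bsub>C\<^esub> f)"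
  by (rule Comp_assoc) (auto simp: Hom_def)

lemma Comp_Ident_Arr [simp]: "f \<in> Arr C \<Longrightarrow> Dom C f = X \<Longrightarrow> f \<cdot>\<^bsub>C\<^esub> Ident C X = f"
  and Ident_Comp_Arr [simp]: "f \<in> Arr C \<Longrightarrow> Cod C f = X \<Longrightarrow> Ident C X \<cdot>\<^bsub>C\<^esub> f = f"
  using Comp_Ident[of f] Ident_Comp[of f] by (auto simp: Hom_def)

text \<open>Simplification associates composites to the right, which hides a known product
  \<open>b\<close> after \<open>a\<close> inside a longer chain. This form applies such an equation
  in the middle of a chain.\<close>

lemma Comp_reduce:
  assumes "b \<cdot>\<^bsub>C\<^esub> a = c" "a \<in> Arr C" "b \<in> Arr C" "Dom C b = Cod C a"
    "x \<in> Arr C" "Cod C x = Dom C a"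
  shows "b \<cdot>\<^bsub>C\<^esub> (a \<cdot>\<^bsub>C\<^esub> x) = c \<cdot>\<^bsub>C\<^esub> x"
  using assms Comp_assoc_Arr[of x a b] by simp

lemma Hom_Obj: "f \<in> Hom C X Y \<Longrightarrow> X \<in> Obj C \<and> Y \<in> Obj C"
  using Dom_in Cod_in by (auto simp: Hom_def)

lemma mono_cancel:
  assumes "monomorphism C m" "g \<in> Arr C" "h \<in> Arr C" "Cod C g = Dom C m" "Cod C h = Dom C m"
    "m \<cdot>\<^bsub>C\<^esub> g = m \<cdot>\<^bsub>C\<^esub> h"
  shows "g = h"
proof -
  have "m \<in> Arr C" using assms(1) by (simp add: monomorphism_def)
  then have "Dom C g = Dom C h" using assms Dom_Comp by metis
  then show ?thesis using assms unfolding monomorphism_def Hom_def by auto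
qed

lemma iso_inverse:
  assumes "isomorphism C f"
  obtains g where "g \<in> Arr C" "Dom C g = Cod C f" "Cod C g = Dom C f"
    "g \<cdot>\<^bsub>C\<^esub> f = Ident C (Dom C f)" "f \<cdot>\<^bsub>C\<^esub> g = Ident C (Cod C f)"
  using assms by (auto simp: isomorphism_def Hom_def)

lemma iso_cancel_left:
  assumes "isomorphism C f" "g \<in> Arr C" "h \<in> Arr C" "Cod C g = Dom C f" "Cod C h = Dom C f"
    "f \<cdot>\<^bsub>C\<^esub> g = f \<cdot>\<^bsub>C\<^esub> h"
  shows "g = h"
proof -
  have "f \<in> Arr C" using assms(1) by (simp add: isomorphism_def)
  then show ?thesis
    using assms Comp_assoc_Arr Ident_Comp_Arr by (metis iso_inverse)
qed

lemma iso_cancel_right: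
  assumes "isomorphism C f" "g \<in> Arr C" "h \<in> Arr C" "Dom C g = Cod C f" "Dom C h = Cod C f"
    "g \<cdot>\<^bsub>C\<^esub> f = h \<cdot>\<^bsub>C\<^esub> f"
  shows "g = h"
proof -
  have "f \<in> Arr C" using assms(1) by (simp add: isomorphism_def)
  then show ?thesis
    using assms Comp_assoc_Arr Comp_Ident_Arr by (metis iso_inverse)
qed

end

text \<open>This says that \<open>m\<close> is an equalizer of \<open>a\<close> and
  \<open>b\<close>; uniqueness of the factorization \<open>u\<close> is carried by the monomorphism
  conjunct.\<close>

definition regular_mono :: "('o, 'm) category \<Rightarrow> 'm \<Rightarrow> bool" where
  "regular_mono C m \<longleftrightarrow> monomorphism C m \<and>
     (\<exists>Z. \<exists>a \<in> Hom C (Cod C m) Z. \<exists>b \<in> Hom C (Cod C m) Z. a \<cdot>\<^bsub>C\<^esub> m = b \<cdot>\<^bsub>C\<^esub> m \<and>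
        (\<forall>W. \<forall>k \<in> Hom C W (Cod C m). a \<cdot>\<^bsub>C\<^esub> k = b \<cdot>\<^bsub>C\<^esub> k \<longrightarrow>
           (\<exists>u \<in> Hom C W (Dom C m). m \<cdot>\<^bsub>C\<^esub> u = k)))"

text \<open>With a left inverse \<open>r\<close>, the arrow \<open>m\<close> equalizes the identity
  and \<open>m r\<close>: if \<open>k = m r k\<close>, then \<open>r k\<close> is the required
  factor.\<close>

lemma (in category) split_embedding_regular_mono:
  assumes "split_embedding C m"
  shows "regular_mono C m"
proof -
  obtain r where m: "m \<in> Arr C" and r: "r \<in> Arr C" "Dom C r = Cod C m" "Cod C r = Dom C m"
    and rm: "r \<cdot>\<^bsub>C\<^esub> m = Ident C (Dom C m)"
    using assms by (auto simp: split_embedding_def Hom_def)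
  have red: "r \<cdot>\<^bsub>C\<^esub> (m \<cdot>\<^bsub>C\<^esub> x) = x" if "x \<in> Arr C" "Cod C x = Dom C m" for x
    using Comp_reduce[OF rm m r(1,2) that] that by simp
  have "monomorphism C m"
    unfolding monomorphism_def Hom_def using m red by (auto, metis)
  moreover have "Ident C (Cod C m) \<in> Hom C (Cod C m) (Cod C m)" "m \<cdot>\<^bsub>C\<^esub> r \<in> Hom C (Cod C m) (Cod C m)"
    using m r Cod_in by (auto simp: Hom_def)
  moreover have "Ident C (Cod C m) \<cdot>\<^bsub>C\<^esub> m = (m \<cdot>\<^bsub>C\<^esub> r) \<cdot>\<^bsub>C\<^esub> m"
    using m r rm Dom_in by simp
  moreover have "\<exists>u \<in> Hom C W (Dom C m). m \<cdot>\<^bsub>C\<^esub> u = k"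
    if "k \<in> Hom C W (Cod C m)" "Ident C (Cod C m) \<cdot>\<^bsub>C\<^esub> k = (m \<cdot>\<^bsub>C\<^esub> r) \<cdot>\<^bsub>C\<^esub> k" for W k
    by (rule bexI[of _ "r \<cdot>\<^bsub>C\<^esub> k"]) (use that m r in \<open>auto simp: Hom_def\<close>)
  ultimately show ?thesis unfolding regular_mono_def by blast
qed

section \<open>Fully faithful functors and equivalences\<close>

context cfunctor
begin

lemma AMap_Arr [simp]: "f \<in> Arr A \<Longrightarrow> AMap F f \<in> Arr B"
  and Dom_AMap [simp]: "f \<in> Arr A \<Longrightarrow> Dom B (AMap F f) = OMap F (Dom A f)"
  and Cod_AMap [simp]: "f \<in> Arr A \<Longrightarrow> Cod B (AMap F f) = OMap F (Cod A f)"
  using AMap_in[of f "Dom A f" "Cod A f"] by (auto simp: Hom_def)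

lemma AMap_Comp_Arr:
  "f \<in> Arr A \<Longrightarrow> g \<in> Arr A \<Longrightarrow> Dom A g = Cod A f \<Longrightarrow> AMap F (g \<cdot>\<^bsub>A\<^esub> f) = AMap F g \<cdot>\<^bsub>B\<^esub> AMap F f"
  by (rule AMap_Comp) (auto simp: Hom_def)

lemma fully_faithfulI:
  assumes "\<And>f g. f \<in> Arr A \<Longrightarrow> g \<in> Arr A \<Longrightarrow> Dom A f = Dom A g \<Longrightarrow> Cod A f = Cod A g \<Longrightarrow>
      AMap F f = AMap F g \<Longrightarrow> f = g"
    and "\<And>X Y h. X \<in> Obj A \<Longrightarrow> Y \<in> Obj A \<Longrightarrow> h \<in> Hom B (OMap F X) (OMap F Y) \<Longrightarrow>
      \<exists>f \<in> Hom A X Y. AMap F f = h"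
  shows "fully_faithful A B F"
  unfolding fully_faithful_def bij_betw_def inj_on_def
  using cfunctor_axioms assms(1) assms(2) AMap_in
  by (auto simp: Hom_def image_iff) (metis (no_types, lifting) Hom_def mem_Collect_eq)

end

lemma fully_faithful_inj:
  assumes "fully_faithful A B F" "f \<in> Arr A" "g \<in> Arr A" "Dom A f = Dom A g" "Cod A f = Cod A g"
    "AMap F f = AMap F g"
  shows "f = g"
proof -
  interpret cfunctor A B F using assms(1) by (simp add: fully_faithful_def)
  have "inj_on (AMap F) (Hom A (Dom A g) (Cod A g))"
    using assms A.Dom_in A.Cod_in by (auto simp: fully_faithful_def bij_betw_def)
  then show ?thesis using assms by (auto simp: inj_on_def Hom_def)
qed

lemma fully_faithful_surj:
  assumes "fully_faithful A B F" "X \<in> Obj A" "Y \<in> Obj A"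
    "h \<in> Hom B (OMap F X) (OMap F Y)"
  obtains f where "f \<in> Hom A X Y" "AMap F f = h"
proof -
  have "h \<in> AMap F ` Hom A X Y"
    using assms by (simp add: fully_faithful_def bij_betw_def)
  then show thesis using that by blast
qed

lemma equivalence_ess_surj:
  assumes "equivalence_of_categories A B F" "Y \<in> Obj B"
  shows "\<exists>X \<in> Obj A. \<exists>u \<in> Hom B (OMap F X) Y. isomorphism B u"
proof -
  obtain G \<beta> where G: "cfunctor B A G"
    and b: "nat_trans B B (F \<circ>\<^sub>F G) id_functor \<beta>" "\<And>Y. Y \<in> Obj B \<Longrightarrow> isomorphism B (\<beta> Y)"
    using assms(1) unfolding equivalence_of_categories_def naturally_isomorphic_def by blast
  show ?thesis
    using nat_trans.component_in[OF b(1) assms(2)] b(2)[OF assms(2)] cfunctor.OMap_in[OF G assms(2)]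
    by (auto simp: id_functor_def comp_functor_def)
qed

text \<open>Naturality of the isomorphisms \<alpha> and \<beta> recovers an arrow from its image
  under \<open>G F\<close> or \<open>F G\<close>, so both functors are faithful. Fullness of
  \<open>F\<close> then follows by comparing images under \<open>G\<close>.\<close>

lemma equivalence_fully_faithful:
  assumes "equivalence_of_categories A B F"
  shows "fully_faithful A B F"
proof -
  obtain G \<alpha> \<beta> where "cfunctor A B F" "cfunctor B A G"
    and \<alpha>: "nat_trans A A id_functor (G \<circ>\<^sub>F F) \<alpha>" and ai: "\<And>X. X \<in> Obj A \<Longrightarrow> isomorphism A (\<alpha> X)"
    and \<beta>: "nat_trans B B (F \<circ>\<^sub>F G) id_functor \<beta>" and bi: "\<And>Y. Y \<in> Obj B \<Longrightarrow> isomorphism B (\<beta> Y)"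
    using assms unfolding equivalence_of_categories_def naturally_isomorphic_def by blast
  interpret F: cfunctor A B F by fact
  interpret G: cfunctor B A G by fact
  have a: "\<alpha> X \<in> Hom A X (OMap G (OMap F X))" if "X \<in> Obj A" for X
    using nat_trans.component_in[OF \<alpha> that] by (simp add: id_functor_def comp_functor_def)
  have an: "\<alpha> (Cod A f) \<cdot>\<^bsub>A\<^esub> f = AMap G (AMap F f) \<cdot>\<^bsub>A\<^esub> \<alpha> (Dom A f)" if "f \<in> Arr A" for f
    using nat_trans.naturality[OF \<alpha>, of f] that by (simp add: id_functor_def comp_functor_def Hom_def)
  have b: "\<beta> Y \<in> Hom B (OMap F (OMap G Y)) Y" if "Y \<in> Obj B" for Y
    using nat_trans.component_in[OF \<beta> that] by (simp add: id_functor_def comp_functor_def)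
  have bn: "\<beta> (Cod B f) \<cdot>\<^bsub>B\<^esub> AMap F (AMap G f) = f \<cdot>\<^bsub>B\<^esub> \<beta> (Dom B f)" if "f \<in> Arr B" for f
    using nat_trans.naturality[OF \<beta>, of f] that by (simp add: id_functor_def comp_functor_def Hom_def)
  have aH: "\<alpha> X \<in> Arr A" "Dom A (\<alpha> X) = X" "Cod A (\<alpha> X) = OMap G (OMap F X)" if "X \<in> Obj A" for X
    using a[OF that] by (auto simp: Hom_def)
  have bH: "\<beta> X \<in> Arr B" "Dom B (\<beta> X) = OMap F (OMap G X)" "Cod B (\<beta> X) = X" if "X \<in> Obj B" for X
    using b[OF that] by (auto simp: Hom_def)
  \<comment> \<open>Naturality expresses \<open>f\<close> after \<beta> through
    \<open>F (G f)\<close>, and the isomorphism \<beta> cancels on the right.\<close>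
  have Gfaithful: "f = g" if "f \<in> Arr B" "g \<in> Arr B" "Dom B f = Dom B g" "Cod B f = Cod B g"
    "AMap G f = AMap G g" for f g
    by (rule F.B.iso_cancel_right[OF bi[of "Dom B f"]])
      (use that bn[of f] bn[of g] bH F.B.Dom_in in auto)
  show ?thesis
  proof (rule F.fully_faithfulI)
    show "f = g" if "f \<in> Arr A" "g \<in> Arr A" "Dom A f = Dom A g" "Cod A f = Cod A g"
      "AMap F f = AMap F g" for f g
      by (rule F.A.iso_cancel_left[OF ai[of "Cod A f"]])
        (use that an[of f] an[of g] aH F.A.Cod_in in auto)
    fix X Y h assume X: "X \<in> Obj A" and Y: "Y \<in> Obj A" and "h \<in> Hom B (OMap F X) (OMap F Y)"
    then have h: "h \<in> Arr B" "Dom B h = OMap F X" "Cod B h = OMap F Y" by (auto simp: Hom_def)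
    obtain c where c: "c \<in> Arr A" "Dom A c = OMap G (OMap F Y)" "Cod A c = Y"
      "\<alpha> Y \<cdot>\<^bsub>A\<^esub> c = Ident A (OMap G (OMap F Y))"
      using F.A.iso_inverse[OF ai[OF Y]] aH[OF Y] by metis
    \<comment> \<open>Naturality of \<alpha> forces this preimage: \<open>\<alpha> Y\<close> after
      it must equal \<open>G h\<close> after \<open>\<alpha> X\<close>, and \<open>c\<close> inverts
      \<open>\<alpha> Y\<close>.\<close>
    define f where "f = c \<cdot>\<^bsub>A\<^esub> (AMap G h \<cdot>\<^bsub>A\<^esub> \<alpha> X)"
    have f: "f \<in> Arr A" "Dom A f = X" "Cod A f = Y"
      using c h aH[OF X] X Y by (auto simp: f_def)
    have "AMap G (AMap F f) \<cdot>\<^bsub>A\<^esub> \<alpha> X = \<alpha> Y \<cdot>\<^bsub>A\<^esub> f" using an[OF f(1)] f by simp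
    also have "\<dots> = AMap G h \<cdot>\<^bsub>A\<^esub> \<alpha> X"
      unfolding f_def using F.A.Comp_reduce[OF c(4) c(1)] c h aH[OF X] aH[OF Y] by simp
    finally have eq: "AMap G (AMap F f) \<cdot>\<^bsub>A\<^esub> \<alpha> X = AMap G h \<cdot>\<^bsub>A\<^esub> \<alpha> X" .
    have G_eq: "AMap G (AMap F f) = AMap G h"
      by (rule F.A.iso_cancel_right[OF ai[OF X] _ _ _ _ eq]) (use f h aH[OF X] in auto)
    have "AMap F f = h" by (rule Gfaithful[OF _ _ _ _ G_eq]) (use f h in auto)
    then show "\<exists>f \<in> Hom A X Y. AMap F f = h" using f by (auto simp: Hom_def)
  qed
qed

text \<open>A quasi-inverse is built by choosing preimages of objects up to isomorphism and lifting
  conjugated arrows along \<open>F\<close>. Every identity in the source category is then checked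
  after applying the faithful functor \<open>F\<close>.\<close>

lemma fully_faithful_ess_surj_equivalence:
  assumes ff: "fully_faithful A B F"
    and es: "\<And>Y. Y \<in> Obj B \<Longrightarrow> \<exists>X \<in> Obj A. \<exists>u \<in> Hom B (OMap F X) Y. isomorphism B u"
  shows "equivalence_of_categories A B F"
proof -
  interpret F: cfunctor A B F using ff by (simp add: fully_faithful_def)
  obtain g \<beta> where g: "\<And>Y. Y \<in> Obj B \<Longrightarrow> g Y \<in> Obj A"
    and b: "\<And>Y. Y \<in> Obj B \<Longrightarrow> \<beta> Y \<in> Hom B (OMap F (g Y)) Y"
    and bi: "\<And>Y. Y \<in> Obj B \<Longrightarrow> isomorphism B (\<beta> Y)"
    using es by metis
  have bH: "\<beta> Y \<in> Arr B" "Dom B (\<beta> Y) = OMap F (g Y)" "Cod B (\<beta> Y) = Y" if "Y \<in> Obj B" for Y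
    using b[OF that] by (auto simp: Hom_def)
  have "\<exists>c. c \<in> Arr B \<and> Dom B c = Y \<and> Cod B c = OMap F (g Y) \<and>
      c \<cdot>\<^bsub>B\<^esub> \<beta> Y = Ident B (OMap F (g Y)) \<and> \<beta> Y \<cdot>\<^bsub>B\<^esub> c = Ident B Y" if "Y \<in> Obj B" for Y
    using F.B.iso_inverse[OF bi[OF that]] bH[OF that] by metis
  then obtain c where cH: "\<And>Y. Y \<in> Obj B \<Longrightarrow> c Y \<in> Arr B" "\<And>Y. Y \<in> Obj B \<Longrightarrow> Dom B (c Y) = Y"
      "\<And>Y. Y \<in> Obj B \<Longrightarrow> Cod B (c Y) = OMap F (g Y)"
    and cb: "\<And>Y. Y \<in> Obj B \<Longrightarrow> c Y \<cdot>\<^bsub>B\<^esub> \<beta> Y = Ident B (OMap F (g Y))"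
    and bc: "\<And>Y. Y \<in> Obj B \<Longrightarrow> \<beta> Y \<cdot>\<^bsub>B\<^esub> c Y = Ident B Y"
    by metis
  note D [simp] = F.B.Dom_in F.B.Cod_in
  \<comment> \<open>The arrow part of the quasi-inverse: \<open>f\<close> is conjugated by the
    isomorphisms \<beta> and their inverses \<open>c\<close>, giving an arrow between images of
    \<open>F\<close>, which lifts by fullness.\<close>
  have "\<exists>h. h \<in> Hom A (g (Dom B f)) (g (Cod B f)) \<and>
      AMap F h = c (Cod B f) \<cdot>\<^bsub>B\<^esub> (f \<cdot>\<^bsub>B\<^esub> \<beta> (Dom B f))" if "f \<in> Arr B" for f
    by (rule fully_faithful_surj[OF ff, of "g (Dom B f)" "g (Cod B f)"
          "c (Cod B f) \<cdot>\<^bsub>B\<^esub> (f \<cdot>\<^bsub>B\<^esub> \<beta> (Dom B f))"])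
      (use that g cH bH in \<open>auto simp: Hom_def\<close>)
  then obtain m where mHom: "\<And>f. f \<in> Arr B \<Longrightarrow> m f \<in> Hom A (g (Dom B f)) (g (Cod B f))"
    and Fm: "\<And>f. f \<in> Arr B \<Longrightarrow> AMap F (m f) = c (Cod B f) \<cdot>\<^bsub>B\<^esub> (f \<cdot>\<^bsub>B\<^esub> \<beta> (Dom B f))"
    by metis
  have mH: "m f \<in> Arr A" "Dom A (m f) = g (Dom B f)" "Cod A (m f) = g (Cod B f)" if "f \<in> Arr B" for f
    using mHom[OF that] by (auto simp: Hom_def)
  have bc_red: "\<beta> Y \<cdot>\<^bsub>B\<^esub> (c Y \<cdot>\<^bsub>B\<^esub> x) = x" if "x \<in> Arr B" "Cod B x = Y" for Y x
    using F.B.Comp_reduce[OF bc[of Y]] that cH bH by auto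
  define G where "G = \<lparr>OMap = g, AMap = m\<rparr>"
  have Gs [simp]: "OMap G = g" "AMap G = m" by (simp_all add: G_def)
  interpret G: cfunctor B A G
  proof
    show "AMap G (Ident B X) = Ident A (OMap G X)" if "X \<in> Obj B" for X
      by (rule fully_faithful_inj[OF ff]) (use that mH Fm cb bH g F.AMap_Ident in auto)
    show "AMap G (h \<cdot>\<^bsub>B\<^esub> f) = AMap G h \<cdot>\<^bsub>A\<^esub> AMap G f" if "f \<in> Hom B X Y" "h \<in> Hom B Y Z" for f h X Y Z
      by (rule fully_faithful_inj[OF ff])
        (use that in \<open>auto simp: Hom_def mH F.AMap_Comp_Arr Fm cH bH bc_red\<close>)
  qed (use g mHom in \<open>auto simp: Hom_def\<close>)
  \<comment> \<open>The unit at \<open>X\<close> is the lift of the inverse of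
    \<open>\<beta> (F X)\<close>, whose source and target are both images of
    \<open>F\<close>.\<close>
  have ex: "\<exists>h. h \<in> Hom A X (g (OMap F X)) \<and> AMap F h = c (OMap F X)" if "X \<in> Obj A" for X
    by (rule fully_faithful_surj[OF ff that, of "g (OMap F X)" "c (OMap F X)"])
      (use that g cH F.OMap_in in \<open>auto simp: Hom_def\<close>)
  then obtain \<alpha> where a: "\<And>X. X \<in> Obj A \<Longrightarrow> \<alpha> X \<in> Hom A X (g (OMap F X))"
    and Fa: "\<And>X. X \<in> Obj A \<Longrightarrow> AMap F (\<alpha> X) = c (OMap F X)"
    by metis
  have aH: "\<alpha> X \<in> Arr A" "Dom A (\<alpha> X) = X" "Cod A (\<alpha> X) = g (OMap F X)" if "X \<in> Obj A" for X
    using a[OF that] by (auto simp: Hom_def)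
  have ai: "isomorphism A (\<alpha> X)" if X: "X \<in> Obj A" for X
  proof -
    have FX: "OMap F X \<in> Obj B" using X by (rule F.OMap_in)
    obtain i where "i \<in> Hom A (g (OMap F X)) X" and Fi: "AMap F i = \<beta> (OMap F X)"
      using fully_faithful_surj[OF ff g[OF FX] X b[OF FX]] by blast
    then have i: "i \<in> Arr A" "Dom A i = g (OMap F X)" "Cod A i = X" by (auto simp: Hom_def)
    have "i \<cdot>\<^bsub>A\<^esub> \<alpha> X = Ident A X" 
      by (rule fully_faithful_inj[OF ff])
        (use i X FX aH[OF X] Fa[OF X] Fi bc F.AMap_Ident in \<open>auto simp: F.AMap_Comp_Arr\<close>)
    moreover have "\<alpha> X \<cdot>\<^bsub>A\<^esub> i = Ident A (g (OMap F X))"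
      by (rule fully_faithful_inj[OF ff])
        (use i X FX g aH[OF X] Fa[OF X] Fi cb F.AMap_Ident in \<open>auto simp: F.AMap_Comp_Arr\<close>)
    ultimately show ?thesis using i aH[OF X] by (auto simp: isomorphism_def Hom_def)
  qed
  have GF: "cfunctor A A (G \<circ>\<^sub>F F)"
    by unfold_locales
      (auto simp: comp_functor_def g F.OMap_in F.AMap_Ident G.AMap_Ident[unfolded Gs] Hom_def mH
        F.AMap_Comp_Arr G.AMap_Comp_Arr[unfolded Gs])
  have FG: "cfunctor B B (F \<circ>\<^sub>F G)"
    by unfold_locales
      (auto simp: comp_functor_def g F.OMap_in F.AMap_Ident G.AMap_Ident[unfolded Gs] Hom_def mH
        F.AMap_Comp_Arr G.AMap_Comp_Arr[unfolded Gs])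
  have idA: "cfunctor A A id_functor" and idB: "cfunctor B B id_functor"
    by unfold_locales (auto simp: id_functor_def)
  have an: "\<alpha> Y \<cdot>\<^bsub>A\<^esub> f = m (AMap F f) \<cdot>\<^bsub>A\<^esub> \<alpha> X" if "f \<in> Hom A X Y" for f X Y
  proof -
    have f: "f \<in> Arr A" "Dom A f = X" "Cod A f = Y" "X \<in> Obj A" "Y \<in> Obj A"
      using that F.A.Hom_Obj[OF that] by (auto simp: Hom_def)
    show ?thesis
      by (rule fully_faithful_inj[OF ff])
        (use f in \<open>auto simp: aH mH F.AMap_Comp_Arr Fa Fm bc cH bH F.OMap_in\<close>)
  qed
  have "naturally_isomorphic A A id_functor (G \<circ>\<^sub>F F)"
    unfolding naturally_isomorphic_def nat_trans_def nat_trans_axioms_def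
    using idA GF ai a an by (auto simp: id_functor_def comp_functor_def)
  moreover have "naturally_isomorphic B B (F \<circ>\<^sub>F G) id_functor"
    unfolding naturally_isomorphic_def nat_trans_def nat_trans_axioms_def
    using idB FG bi b
    by (intro exI[of _ \<beta>]) (auto simp: id_functor_def comp_functor_def Hom_def Fm bc_red bH)
  ultimately show ?thesis
    unfolding equivalence_of_categories_def using F.cfunctor_axioms G.cfunctor_axioms by blast
qed

section \<open>Full faithfulness of the comparison functor\<close>

context adjunction
begin

lemma eta_Arr [simp]: "X \<in> Obj B \<Longrightarrow> \<eta> X \<in> Arr B"
  and Dom_eta [simp]: "X \<in> Obj B \<Longrightarrow> Dom B (\<eta> X) = X"
  and Cod_eta [simp]: "X \<in> Obj B \<Longrightarrow> Cod B (\<eta> X) = OMap Q (OMap P X)"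
  using eta_in by (auto simp: Hom_def)

lemma eps_Arr [simp]: "X \<in> Obj C \<Longrightarrow> \<epsilon> X \<in> Arr C"
  and Dom_eps [simp]: "X \<in> Obj C \<Longrightarrow> Dom C (\<epsilon> X) = OMap P (OMap Q X)"
  and Cod_eps [simp]: "X \<in> Obj C \<Longrightarrow> Cod C (\<epsilon> X) = X"
  using eps_in by (auto simp: Hom_def)

lemma eta_natural:
  "f \<in> Arr B \<Longrightarrow> Dom B f = X \<Longrightarrow> Cod B f = Y \<Longrightarrow> \<eta> Y \<cdot>\<^bsub>B\<^esub> f = AMap Q (AMap P f) \<cdot>\<^bsub>B\<^esub> \<eta> X"
  by (rule eta_nat) (simp add: Hom_def)

lemma eps_natural:
  "f \<in> Arr C \<Longrightarrow> Dom C f = X \<Longrightarrow> Cod C f = Y \<Longrightarrow> \<epsilon> Y \<cdot>\<^bsub>C\<^esub> AMap P (AMap Q f) = f \<cdot>\<^bsub>C\<^esub> \<epsilon> X"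
  by (rule eps_nat) (simp add: Hom_def)

lemma eps_P_eta_reduce:
  assumes "H \<in> Obj B" "x \<in> Arr C" "Cod C x = OMap P H"
  shows "\<epsilon> (OMap P H) \<cdot>\<^bsub>C\<^esub> (AMap P (\<eta> H) \<cdot>\<^bsub>C\<^esub> x) = x"
  using C.Comp_reduce[OF triangle_left[OF assms(1)], of x] assms P.OMap_in by simp

text \<open>The left triangle identity gives \<open>\<epsilon> (P H)\<close> after
  \<open>P (\<eta> H x)\<close> equal to \<open>P x\<close>. Hence arrows that agree after
  \<open>\<eta> H\<close> have the same image under \<open>P\<close>, and being parallel they have
  the same image under the comparison functor.\<close>

lemma comparison_fully_faithful_eta_mono:
  assumes ff: "fully_faithful B (comodule_category C (adjunction_comonad P Q \<eta> \<epsilon>)) (comparison_functor B P \<eta>)"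
    and H: "H \<in> Obj B"
  shows "monomorphism B (\<eta> H)"
  unfolding monomorphism_def
proof (intro conjI allI ballI impI)
  show "\<eta> H \<in> Arr B" using H by simp
  fix W f g
  assume "f \<in> Hom B W (Dom B (\<eta> H))" "g \<in> Hom B W (Dom B (\<eta> H))" and eq: "\<eta> H \<cdot>\<^bsub>B\<^esub> f = \<eta> H \<cdot>\<^bsub>B\<^esub> g"
  then have f: "f \<in> Arr B" "Dom B f = W" "Cod B f = H" and g: "g \<in> Arr B" "Dom B g = W" "Cod B g = H"
    using H by (auto simp: Hom_def)
  have *: "\<epsilon> (OMap P H) \<cdot>\<^bsub>C\<^esub> AMap P (\<eta> H \<cdot>\<^bsub>B\<^esub> x) = AMap P x" if "x \<in> Arr B" "Cod B x = H" for x
    using eps_P_eta_reduce[OF H, of "AMap P x"] that H by (simp add: P.AMap_Comp_Arr)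
  have "AMap P f = AMap P g" using *[OF f(1,3)] *[OF g(1,3)] eq by metis
  then have "AMap (comparison_functor B P \<eta>) f = AMap (comparison_functor B P \<eta>) g"
    using f g by (simp add: comparison_functor_def)
  then show "f = g" using fully_faithful_inj[OF ff] f g by simp
qed

lemma eta_regular_mono_comparison_fully_faithful:
  assumes reg: "\<And>H. H \<in> Obj B \<Longrightarrow> regular_mono B (\<eta> H)"
  shows "fully_faithful B (comodule_category C (adjunction_comonad P Q \<eta> \<epsilon>)) (comparison_functor B P \<eta>)"
proof -
  have mono: "monomorphism B (\<eta> H)" if "H \<in> Obj B" for H
    using reg[OF that] by (simp add: regular_mono_def)
  interpret \<Phi>: cfunctor B "comodule_category C (adjunction_comonad P Q \<eta> \<epsilon>)" "comparison_functor B P \<eta>"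
    by (rule cfunctor_comparison)
  show ?thesis
  proof (rule \<Phi>.fully_faithfulI)
    fix f g
    assume f: "f \<in> Arr B" and g: "g \<in> Arr B" and par: "Dom B f = Dom B g" "Cod B f = Cod B g"
      and "AMap (comparison_functor B P \<eta>) f = AMap (comparison_functor B P \<eta>) g"
    then have "AMap P f = AMap P g" by (simp add: comparison_functor_def)
    \<comment> \<open>By naturality, composing an arrow with the unit at its target gives a result
      that depends only on its image under \<open>P\<close>.\<close>
    then have "\<eta> (Cod B g) \<cdot>\<^bsub>B\<^esub> f = \<eta> (Cod B g) \<cdot>\<^bsub>B\<^esub> g"
      using eta_natural[OF f refl refl] eta_natural[OF g refl refl] par by simp
    then show "f = g"
      using B.mono_cancel[OF mono[of "Cod B g"] f g] par g B.Cod_in by simp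
  next
    fix X Y \<phi>
    assume X: "X \<in> Obj B" and Y: "Y \<in> Obj B"
      and "\<phi> \<in> Hom (comodule_category C (adjunction_comonad P Q \<eta> \<epsilon>))
        (OMap (comparison_functor B P \<eta>) X) (OMap (comparison_functor B P \<eta>) Y)"
    then obtain f where \<phi>: "\<phi> = ((OMap P X, AMap P (\<eta> X)), f, (OMap P Y, AMap P (\<eta> Y)))"
      and "f \<in> Hom C (OMap P X) (OMap P Y)"
      and comm: "AMap P (AMap Q f) \<cdot>\<^bsub>C\<^esub> AMap P (\<eta> X) = AMap P (\<eta> Y) \<cdot>\<^bsub>C\<^esub> f"
      by (auto simp: comparison_functor_def Hom_comodule_category)
    then have f: "f \<in> Arr C" "Dom C f = OMap P X" "Cod C f = OMap P Y" by (auto simp: Hom_def)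
    note O [simp] = X Y P.OMap_in[OF X] P.OMap_in[OF Y] Q.OMap_in[OF P.OMap_in[OF X]]
      Q.OMap_in[OF P.OMap_in[OF Y]]
    \<comment> \<open>This is the adjunct of \<open>f\<close>. If \<open>f = P g\<close>, then
      naturality makes it \<open>\<eta> Y\<close> after \<open>g\<close>, so a preimage of
      \<open>f\<close> must be a factorization of \<open>k\<close> through
      \<open>\<eta> Y\<close>.\<close>
    define k where "k = AMap Q f \<cdot>\<^bsub>B\<^esub> \<eta> X"
    have k: "k \<in> Arr B" "Dom B k = X" "Cod B k = OMap Q (OMap P Y)" using f by (auto simp: k_def)
    obtain Z a b where "a \<in> Hom B (OMap Q (OMap P Y)) Z" "b \<in> Hom B (OMap Q (OMap P Y)) Z"
      and ab: "a \<cdot>\<^bsub>B\<^esub> \<eta> Y = b \<cdot>\<^bsub>B\<^esub> \<eta> Y"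
      and fac: "\<And>W k. k \<in> Hom B W (OMap Q (OMap P Y)) \<Longrightarrow> a \<cdot>\<^bsub>B\<^esub> k = b \<cdot>\<^bsub>B\<^esub> k \<Longrightarrow>
        \<exists>u \<in> Hom B W Y. \<eta> Y \<cdot>\<^bsub>B\<^esub> u = k"
      using reg[OF Y] unfolding regular_mono_def by auto
    then have a: "a \<in> Arr B" "Dom B a = OMap Q (OMap P Y)" "Cod B a = Z"
      and b: "b \<in> Arr B" "Dom B b = OMap Q (OMap P Y)" "Cod B b = Z"
      by (auto simp: Hom_def)
    have Z: "Z \<in> Obj B" using a B.Cod_in by blast
    \<comment> \<open>The comodule square for \<open>f\<close>, rewritten as a statement about the
      adjunct.\<close>
    have Pk: "AMap P k = AMap P (\<eta> Y) \<cdot>\<^bsub>C\<^esub> f"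
      using comm f by (simp add: k_def P.AMap_Comp_Arr)
    \<comment> \<open>By naturality of the unit, \<open>\<eta>\<^sub>Z c k = QP(c \<eta>\<^sub>Y) Qf \<eta>\<^sub>X\<close> depends on \<open>c\<close> only through \<open>c \<eta>\<^sub>Y\<close>.\<close>
    have key: "\<eta> Z \<cdot>\<^bsub>B\<^esub> (c \<cdot>\<^bsub>B\<^esub> k) = AMap Q (AMap P (c \<cdot>\<^bsub>B\<^esub> \<eta> Y)) \<cdot>\<^bsub>B\<^esub> k"
      if c: "c \<in> Arr B" "Dom B c = OMap Q (OMap P Y)" "Cod B c = Z" for c
    proof -
      have "\<eta> Z \<cdot>\<^bsub>B\<^esub> (c \<cdot>\<^bsub>B\<^esub> k) = AMap Q (AMap P (c \<cdot>\<^bsub>B\<^esub> k)) \<cdot>\<^bsub>B\<^esub> \<eta> X"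
        by (rule eta_natural) (use c k in auto)
      also have "AMap P (c \<cdot>\<^bsub>B\<^esub> k) = AMap P (c \<cdot>\<^bsub>B\<^esub> \<eta> Y) \<cdot>\<^bsub>C\<^esub> f"
        using c k f by (simp add: P.AMap_Comp_Arr Pk)
      also have "AMap Q \<dots> \<cdot>\<^bsub>B\<^esub> \<eta> X = AMap Q (AMap P (c \<cdot>\<^bsub>B\<^esub> \<eta> Y)) \<cdot>\<^bsub>B\<^esub> k"
        using c f by (simp add: Q.AMap_Comp_Arr P.AMap_Comp_Arr k_def)
      finally show ?thesis .
    qed
    \<comment> \<open>Equality is tested after the monic unit at \<open>Z\<close>, where
      \<open>key\<close> leaves only the composites of \<open>a\<close> and \<open>b\<close> with
      \<open>\<eta> Y\<close>, which agree.\<close>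
    have "a \<cdot>\<^bsub>B\<^esub> k = b \<cdot>\<^bsub>B\<^esub> k"
      by (rule B.mono_cancel[OF mono[OF Z]]) (use a b k Z key ab in auto)
    then obtain g where "g \<in> Hom B X Y" and \<eta>g: "\<eta> Y \<cdot>\<^bsub>B\<^esub> g = k"
      using fac[of k X] k by (auto simp: Hom_def)
    then have g: "g \<in> Arr B" "Dom B g = X" "Cod B g = Y" by (auto simp: Hom_def)
    \<comment> \<open>The counit strips the split monic \<open>P (\<eta> Y)\<close> from both sides,
      identifying \<open>P g\<close> with \<open>f\<close>.\<close>
    have "AMap P g = \<epsilon> (OMap P Y) \<cdot>\<^bsub>C\<^esub> (AMap P (\<eta> Y) \<cdot>\<^bsub>C\<^esub> AMap P g)"
      using eps_P_eta_reduce[OF Y, of "AMap P g"] g by simp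
    also have "\<dots> = \<epsilon> (OMap P Y) \<cdot>\<^bsub>C\<^esub> (AMap P (\<eta> Y) \<cdot>\<^bsub>C\<^esub> f)"
      using Pk \<eta>g P.AMap_Comp_Arr[of g "\<eta> Y"] g by simp
    also have "\<dots> = f" using eps_P_eta_reduce[OF Y, of f] f by simp
    finally have "AMap (comparison_functor B P \<eta>) g = \<phi>"
      using g by (simp add: comparison_functor_def \<phi>)
    then show "\<exists>g \<in> Hom B X Y. AMap (comparison_functor B P \<eta>) g = \<phi>" using \<open>g \<in> Hom B X Y\<close> by blast
  qed
qed

end

section \<open>Additive and abelian categories\<close>

context additive_category
begin

lemma zero_Arr [simp]: "X \<in> Obj C \<Longrightarrow> Y \<in> Obj C \<Longrightarrow> zero_arr A X Y \<in> Arr C"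
  and Dom_zero [simp]: "X \<in> Obj C \<Longrightarrow> Y \<in> Obj C \<Longrightarrow> Dom C (zero_arr A X Y) = X"
  and Cod_zero [simp]: "X \<in> Obj C \<Longrightarrow> Y \<in> Obj C \<Longrightarrow> Cod C (zero_arr A X Y) = Y"
proof -
  assume "X \<in> Obj C" "Y \<in> Obj C"
  then have "zero_arr A X Y \<in> Hom C X Y"
    using hom_group carrier_hom_group comm_group.axioms(1) monoid.one_closed comm_monoid_def by metis
  then show "zero_arr A X Y \<in> Arr C" "Dom C (zero_arr A X Y) = X" "Cod C (zero_arr A X Y) = Y"
    by (auto simp: Hom_def)
qed

lemma group_hom: "f \<in> Hom C X Y \<Longrightarrow> comm_group (A X Y)"
  using Hom_Obj hom_group by blast

lemma inv_Hom: "f \<in> Hom C X Y \<Longrightarrow> inv\<^bsub>A X Y\<^esub> f \<in> Hom C X Y"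
  and mult_Hom: "f \<in> Hom C X Y \<Longrightarrow> g \<in> Hom C X Y \<Longrightarrow> f \<otimes>\<^bsub>A X Y\<^esub> g \<in> Hom C X Y"
proof -
  assume f: "f \<in> Hom C X Y"
  interpret G: comm_group "A X Y" using group_hom f .
  have c: "carrier (A X Y) = Hom C X Y" using carrier_hom_group Hom_Obj f by blast
  show "inv\<^bsub>A X Y\<^esub> f \<in> Hom C X Y" using f c G.inv_closed by blast
  show "g \<in> Hom C X Y \<Longrightarrow> f \<otimes>\<^bsub>A X Y\<^esub> g \<in> Hom C X Y" using f c G.m_closed by blast
qed

lemma zero_Hom: "X \<in> Obj C \<Longrightarrow> Y \<in> Obj C \<Longrightarrow> zero_arr A X Y \<in> Hom C X Y"
  by (simp add: Hom_def)

text \<open>This identifies images of zero under additive operations: additivity alone shows that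
  such an image equals its own double, and cancellation in the hom group does the rest.\<close>

lemma idempotent_zero:
  assumes "f \<in> Hom C X Y" "f \<otimes>\<^bsub>A X Y\<^esub> f = f"
  shows "f = zero_arr A X Y"
proof -
  interpret G: comm_group "A X Y" using group_hom assms(1) .
  have "f \<in> carrier (A X Y)" using carrier_hom_group Hom_Obj assms(1) by blast
  then show ?thesis using assms(2) G.r_cancel_one' by auto
qed

lemma zero_add_zero: "X \<in> Obj C \<Longrightarrow> Y \<in> Obj C \<Longrightarrow> zero_arr A X Y \<otimes>\<^bsub>A X Y\<^esub> zero_arr A X Y = zero_arr A X Y"
proof -
  assume "X \<in> Obj C" "Y \<in> Obj C"
  then interpret G: comm_group "A X Y" using hom_group by blast
  show ?thesis by simp
qed

lemma Comp_zero [simp]: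
  assumes "f \<in> Arr C" "Dom C f = Y" "X \<in> Obj C"
  shows "f \<cdot>\<^bsub>C\<^esub> zero_arr A X Y = zero_arr A X (Cod C f)"
proof (rule idempotent_zero)
  have Y: "Y \<in> Obj C" "Cod C f \<in> Obj C" using assms Dom_in Cod_in by auto
  show "f \<cdot>\<^bsub>C\<^esub> zero_arr A X Y \<in> Hom C X (Cod C f)" using assms Y by (simp add: Hom_def)
  show "(f \<cdot>\<^bsub>C\<^esub> zero_arr A X Y) \<otimes>\<^bsub>A X (Cod C f)\<^esub> (f \<cdot>\<^bsub>C\<^esub> zero_arr A X Y) = f \<cdot>\<^bsub>C\<^esub> zero_arr A X Y"
    using Comp_add_right[OF zero_Hom zero_Hom, of X Y f "Cod C f"] zero_add_zero[of X Y] assms Y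
    by (simp add: Hom_def)
qed

lemma zero_Comp [simp]:
  assumes "f \<in> Arr C" "Cod C f = Y" "Z \<in> Obj C"
  shows "zero_arr A Y Z \<cdot>\<^bsub>C\<^esub> f = zero_arr A (Dom C f) Z"
proof (rule idempotent_zero)
  have Y: "Y \<in> Obj C" "Dom C f \<in> Obj C" using assms Dom_in Cod_in by auto
  show "zero_arr A Y Z \<cdot>\<^bsub>C\<^esub> f \<in> Hom C (Dom C f) Z" using assms Y by (simp add: Hom_def)
  show "(zero_arr A Y Z \<cdot>\<^bsub>C\<^esub> f) \<otimes>\<^bsub>A (Dom C f) Z\<^esub> (zero_arr A Y Z \<cdot>\<^bsub>C\<^esub> f) = zero_arr A Y Z \<cdot>\<^bsub>C\<^esub> f"
    using Comp_add_left[of f "Dom C f" Y "zero_arr A Y Z" Z "zero_arr A Y Z"] zero_add_zero[of Y Z] assms Y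
    by (simp add: Hom_def)
qed

lemma add_inv: "f \<in> Hom C X Y \<Longrightarrow> f \<otimes>\<^bsub>A X Y\<^esub> inv\<^bsub>A X Y\<^esub> f = zero_arr A X Y"
proof -
  assume f: "f \<in> Hom C X Y"
  interpret G: comm_group "A X Y" using group_hom f .
  show ?thesis using f carrier_hom_group Hom_Obj G.r_inv by blast
qed

lemma inv_unique:
  assumes "f \<in> Hom C X Y" "g \<in> Hom C X Y" "f \<otimes>\<^bsub>A X Y\<^esub> g = zero_arr A X Y"
  shows "g = inv\<^bsub>A X Y\<^esub> f"
proof -
  interpret G: comm_group "A X Y" using group_hom assms(1) .
  have "f \<in> carrier (A X Y)" "g \<in> carrier (A X Y)" using assms carrier_hom_group Hom_Obj by blast+
  then show ?thesis using assms(3) G.inv_equality G.m_comm by metis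
qed

lemma inv_inv_Hom: "f \<in> Hom C X Y \<Longrightarrow> inv\<^bsub>A X Y\<^esub> (inv\<^bsub>A X Y\<^esub> f) = f"
proof -
  assume f: "f \<in> Hom C X Y"
  interpret G: comm_group "A X Y" using group_hom f .
  show ?thesis using f carrier_hom_group Hom_Obj G.inv_inv by blast
qed

lemma inv_zero: "X \<in> Obj C \<Longrightarrow> Y \<in> Obj C \<Longrightarrow> inv\<^bsub>A X Y\<^esub> (zero_arr A X Y) = zero_arr A X Y"
  using inv_unique[OF zero_Hom zero_Hom zero_add_zero] by simp

lemma diff_eq_zero_iff:
  assumes "f \<in> Hom C X Y" "g \<in> Hom C X Y"
  shows "f \<otimes>\<^bsub>A X Y\<^esub> inv\<^bsub>A X Y\<^esub> g = zero_arr A X Y \<longleftrightarrow> f = g"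
  using inv_unique[OF assms(1) inv_Hom[OF assms(2)]] add_inv assms inv_inv_Hom by metis

lemma Comp_inv:
  assumes "f \<in> Hom C X Y" "g \<in> Hom C Y Z"
  shows "g \<cdot>\<^bsub>C\<^esub> inv\<^bsub>A X Y\<^esub> f = inv\<^bsub>A X Z\<^esub> (g \<cdot>\<^bsub>C\<^esub> f)"
proof (rule inv_unique)
  show "g \<cdot>\<^bsub>C\<^esub> f \<in> Hom C X Z" "g \<cdot>\<^bsub>C\<^esub> inv\<^bsub>A X Y\<^esub> f \<in> Hom C X Z"
    using assms inv_Hom Comp_in by blast+
  have "(g \<cdot>\<^bsub>C\<^esub> f) \<otimes>\<^bsub>A X Z\<^esub> (g \<cdot>\<^bsub>C\<^esub> inv\<^bsub>A X Y\<^esub> f) = g \<cdot>\<^bsub>C\<^esub> zero_arr A X Y"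
    using Comp_add_right[OF assms(1) inv_Hom[OF assms(1)] assms(2)] add_inv[OF assms(1)] by simp
  then show "(g \<cdot>\<^bsub>C\<^esub> f) \<otimes>\<^bsub>A X Z\<^esub> (g \<cdot>\<^bsub>C\<^esub> inv\<^bsub>A X Y\<^esub> f) = zero_arr A X Z"
    using assms Hom_Obj by (auto simp: Hom_def)
qed

lemma inv_Comp:
  assumes "f \<in> Hom C X Y" "g \<in> Hom C Y Z"
  shows "inv\<^bsub>A Y Z\<^esub> g \<cdot>\<^bsub>C\<^esub> f = inv\<^bsub>A X Z\<^esub> (g \<cdot>\<^bsub>C\<^esub> f)"
proof (rule inv_unique)
  show "g \<cdot>\<^bsub>C\<^esub> f \<in> Hom C X Z" "inv\<^bsub>A Y Z\<^esub> g \<cdot>\<^bsub>C\<^esub> f \<in> Hom C X Z"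
    using assms inv_Hom Comp_in by blast+
  have "(g \<cdot>\<^bsub>C\<^esub> f) \<otimes>\<^bsub>A X Z\<^esub> (inv\<^bsub>A Y Z\<^esub> g \<cdot>\<^bsub>C\<^esub> f) = zero_arr A Y Z \<cdot>\<^bsub>C\<^esub> f"
    using Comp_add_left[OF assms(1) assms(2) inv_Hom[OF assms(2)]] add_inv[OF assms(2)] by simp
  then show "(g \<cdot>\<^bsub>C\<^esub> f) \<otimes>\<^bsub>A X Z\<^esub> (inv\<^bsub>A Y Z\<^esub> g \<cdot>\<^bsub>C\<^esub> f) = zero_arr A X Z"
    using assms Hom_Obj by (auto simp: Hom_def)
qed

lemma Comp_diff_right:
  assumes "f \<in> Hom C X Y" "g \<in> Hom C X Y" "h \<in> Hom C Y Z"
  shows "h \<cdot>\<^bsub>C\<^esub> (f \<otimes>\<^bsub>A X Y\<^esub> inv\<^bsub>A X Y\<^esub> g) = (h \<cdot>\<^bsub>C\<^esub> f) \<otimes>\<^bsub>A X Z\<^esub> inv\<^bsub>A X Z\<^esub> (h \<cdot>\<^bsub>C\<^esub> g)"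
  using Comp_add_right[OF assms(1) inv_Hom[OF assms(2)] assms(3)] Comp_inv[OF assms(2,3)] by simp

lemma Comp_diff_left:
  assumes "f \<in> Hom C X Y" "g \<in> Hom C Y Z" "h \<in> Hom C Y Z"
  shows "(g \<otimes>\<^bsub>A Y Z\<^esub> inv\<^bsub>A Y Z\<^esub> h) \<cdot>\<^bsub>C\<^esub> f = (g \<cdot>\<^bsub>C\<^esub> f) \<otimes>\<^bsub>A X Z\<^esub> inv\<^bsub>A X Z\<^esub> (h \<cdot>\<^bsub>C\<^esub> f)"
  using Comp_add_left[OF assms(1,2) inv_Hom[OF assms(3)]] inv_Comp[OF assms(1,3)] by simp

text \<open>If the identity of \<open>X\<close> is zero, composing with it shows that every arrow
  into or out of \<open>X\<close> is zero. This reduces vanishing of an object to an equation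
  between arrows.\<close>

lemma zero_object_iff:
  assumes X: "X \<in> Obj C"
  shows "zero_object C X \<longleftrightarrow> Ident C X = zero_arr A X X"
proof
  assume "zero_object C X"
  then show "Ident C X = zero_arr A X X"
    using X Ident_in zero_Hom unfolding zero_object_def by blast
next
  assume id: "Ident C X = zero_arr A X X"
  have "f = zero_arr A X Y" if f: "f \<in> Hom C X Y" for f Y
    using Comp_Ident[OF f] f Hom_Obj[OF f] id by (auto simp: Hom_def)
  moreover have "f = zero_arr A Y X" if f: "f \<in> Hom C Y X" for f Y
    using Ident_Comp[OF f] f Hom_Obj[OF f] id by (auto simp: Hom_def)
  ultimately show "zero_object C X"
    unfolding zero_object_def using X zero_Hom by metis
qed

section \<open>Monomorphisms, kernels and cokernels\<close>

lemma monomorphismI: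
  assumes m: "m \<in> Arr C"
    and z: "\<And>k. k \<in> Arr C \<Longrightarrow> Cod C k = Dom C m \<Longrightarrow> m \<cdot>\<^bsub>C\<^esub> k = zero_arr A (Dom C k) (Cod C m) \<Longrightarrow>
      k = zero_arr A (Dom C k) (Dom C m)"
  shows "monomorphism C m"
  unfolding monomorphism_def
proof (intro conjI allI ballI impI)
  fix W f g
  assume f: "f \<in> Hom C W (Dom C m)" and g: "g \<in> Hom C W (Dom C m)" and eq: "m \<cdot>\<^bsub>C\<^esub> f = m \<cdot>\<^bsub>C\<^esub> g"
  \<comment> \<open>The difference of the two test arrows, which \<open>m\<close>
    annihilates.\<close>
  define k where "k = f \<otimes>\<^bsub>A W (Dom C m)\<^esub> inv\<^bsub>A W (Dom C m)\<^esub> g"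
  have mH: "m \<in> Hom C (Dom C m) (Cod C m)" using m by (simp add: Hom_def)
  have "k \<in> Hom C W (Dom C m)" using f g mult_Hom inv_Hom by (simp add: k_def)
  moreover have "m \<cdot>\<^bsub>C\<^esub> k = zero_arr A W (Cod C m)"
    using Comp_diff_right[OF f g mH] eq add_inv[OF Comp_in[OF g mH]] by (simp add: k_def)
  ultimately have "k = zero_arr A W (Dom C m)" using z[of k] by (auto simp: Hom_def)
  then show "f = g" using diff_eq_zero_iff[OF f g] by (simp add: k_def)
qed (fact m)

text \<open>An arrow \<open>x\<close> killed by \<open>k\<close> and the zero arrow both factor the
  zero arrow through \<open>k\<close>, so uniqueness of the factorization makes them equal.\<close>

lemma kernel_mono: "is_kernel C A k f \<Longrightarrow> monomorphism C k"
proof (rule monomorphismI)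
  assume k: "is_kernel C A k f"
  then show kA: "k \<in> Arr C" by (simp add: is_kernel_def)
  fix x assume x: "x \<in> Arr C" "Cod C x = Dom C k" "k \<cdot>\<^bsub>C\<^esub> x = zero_arr A (Dom C x) (Cod C k)"
  have f: "f \<in> Arr C" "Dom C f = Cod C k" using k by (auto simp: is_kernel_def)
  have O: "Dom C x \<in> Obj C" "Dom C k \<in> Obj C" "Cod C k \<in> Obj C" "Dom C f \<in> Obj C"
    using x kA f Dom_in Cod_in by auto
  have "zero_arr A (Dom C x) (Cod C k) \<in> Hom C (Dom C x) (Dom C f)"
    "f \<cdot>\<^bsub>C\<^esub> zero_arr A (Dom C x) (Cod C k) = zero_arr A (Dom C x) (Cod C f)"
    using O f zero_Hom by auto
  then have "\<exists>!u. u \<in> Hom C (Dom C x) (Dom C k) \<and> k \<cdot>\<^bsub>C\<^esub> u = zero_arr A (Dom C x) (Cod C k)"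
    using k unfolding is_kernel_def by blast
  moreover have "x \<in> Hom C (Dom C x) (Dom C k)" using x by (simp add: Hom_def)
  moreover have "k \<cdot>\<^bsub>C\<^esub> zero_arr A (Dom C x) (Dom C k) = zero_arr A (Dom C x) (Cod C k)"
    using O kA by simp
  ultimately show "x = zero_arr A (Dom C x) (Dom C k)" using x(3) zero_Hom[OF O(1,2)] by blast
qed

text \<open>Both \<open>x\<close> and \<open>y\<close> factor the single arrow \<open>y q\<close>,
  which kills \<open>f\<close>; the universal property admits only one such factor.\<close>

lemma cokernel_cancel:
  assumes q: "is_cokernel C A q f" and "x \<in> Hom C (Cod C q) Z" "y \<in> Hom C (Cod C q) Z"
    "x \<cdot>\<^bsub>C\<^esub> q = y \<cdot>\<^bsub>C\<^esub> q"
  shows "x = y"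
proof -
  have qA: "q \<in> Arr C" "f \<in> Arr C" "Dom C q = Cod C f" "q \<cdot>\<^bsub>C\<^esub> f = zero_arr A (Dom C f) (Cod C q)"
    using q by (auto simp: is_cokernel_def)
  have y: "y \<in> Arr C" "Dom C y = Cod C q" "Cod C y = Z" using assms by (auto simp: Hom_def)
  have "(y \<cdot>\<^bsub>C\<^esub> q) \<cdot>\<^bsub>C\<^esub> f = zero_arr A (Dom C f) Z"
    using qA y Dom_in by simp
  moreover have "y \<cdot>\<^bsub>C\<^esub> q \<in> Hom C (Cod C f) Z" using qA y by (simp add: Hom_def)
  ultimately have "\<exists>!u. u \<in> Hom C (Cod C q) Z \<and> u \<cdot>\<^bsub>C\<^esub> q = y \<cdot>\<^bsub>C\<^esub> q"
    using q unfolding is_cokernel_def by blast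
  then show ?thesis using assms by blast
qed

lemma kernel_factor:
  assumes "is_kernel C A k f" "x \<in> Arr C" "Cod C x = Cod C k" "f \<cdot>\<^bsub>C\<^esub> x = zero_arr A (Dom C x) (Cod C f)"
  obtains u where "u \<in> Arr C" "Dom C u = Dom C x" "Cod C u = Dom C k" "k \<cdot>\<^bsub>C\<^esub> u = x"
proof -
  have "x \<in> Hom C (Dom C x) (Dom C f)" using assms by (simp add: Hom_def is_kernel_def)
  then have "\<exists>u. u \<in> Hom C (Dom C x) (Dom C k) \<and> k \<cdot>\<^bsub>C\<^esub> u = x"
    using assms(1,4) unfolding is_kernel_def by blast
  then show thesis using that by (auto simp: Hom_def)
qed

lemma cokernel_factor:
  assumes "is_cokernel C A q f" "x \<in> Arr C" "Dom C x = Dom C q" "x \<cdot>\<^bsub>C\<^esub> f = zero_arr A (Dom C f) (Cod C x)"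
  obtains u where "u \<in> Arr C" "Dom C u = Cod C q" "Cod C u = Cod C x" "u \<cdot>\<^bsub>C\<^esub> q = x"
proof -
  have "x \<in> Hom C (Cod C f) (Cod C x)" using assms by (simp add: Hom_def is_cokernel_def)
  then have "\<exists>u. u \<in> Hom C (Cod C q) (Cod C x) \<and> u \<cdot>\<^bsub>C\<^esub> q = x"
    using assms(1,4) unfolding is_cokernel_def by blast
  then show thesis using that by (auto simp: Hom_def)
qed

end

section \<open>Image factorization in an abelian category\<close>

context abelian_category
begin

text \<open>A kernel of \<open>g\<close> is an equalizer of \<open>g\<close> and the zero
  arrow.\<close>

lemma mono_regular_mono:
  assumes "monomorphism C m"
  shows "regular_mono C m"
proof -
  obtain g where k: "is_kernel C A m g" using mono_is_kernel assms by blast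
  then have mg: "m \<in> Arr C" "g \<in> Arr C" "Dom C g = Cod C m" "g \<cdot>\<^bsub>C\<^esub> m = zero_arr A (Dom C m) (Cod C g)"
    by (auto simp: is_kernel_def)
  have O: "Cod C m \<in> Obj C" "Cod C g \<in> Obj C" using mg Cod_in by auto
  have "\<exists>u \<in> Hom C W (Dom C m). m \<cdot>\<^bsub>C\<^esub> u = x"
    if "x \<in> Hom C W (Cod C m)" "g \<cdot>\<^bsub>C\<^esub> x = zero_arr A (Cod C m) (Cod C g) \<cdot>\<^bsub>C\<^esub> x" for W x
    using kernel_factor[OF k, of x] that O by (auto simp: Hom_def)
  moreover have "g \<in> Hom C (Cod C m) (Cod C g)" using mg by (simp add: Hom_def)
  moreover have "g \<cdot>\<^bsub>C\<^esub> m = zero_arr A (Cod C m) (Cod C g) \<cdot>\<^bsub>C\<^esub> m" using mg O by simp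
  ultimately show ?thesis
    unfolding regular_mono_def using assms zero_Hom[OF O] by blast
qed

text \<open>A monomorphism is the kernel of its cokernel. It is a kernel of some \<open>g\<close>,
  and \<open>g\<close> factors as \<open>t q\<close>; thus \<open>q j = 0\<close> implies
  \<open>g j = 0\<close>, and the universal property for \<open>g\<close> transfers to
  \<open>q\<close>.\<close>

lemma mono_short_exact:
  assumes "monomorphism C k" and q: "is_cokernel C A q k"
  shows "short_exact C A k q"
proof -
  obtain g where k: "is_kernel C A k g" using mono_is_kernel assms by blast
  have kg: "k \<in> Arr C" "g \<in> Arr C" "Dom C g = Cod C k" "g \<cdot>\<^bsub>C\<^esub> k = zero_arr A (Dom C k) (Cod C g)"
    using k by (auto simp: is_kernel_def)
  have qk: "q \<in> Arr C" "Dom C q = Cod C k" "q \<cdot>\<^bsub>C\<^esub> k = zero_arr A (Dom C k) (Cod C q)"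
    using q by (auto simp: is_cokernel_def)
  obtain t where t: "t \<in> Arr C" "Dom C t = Cod C q" "Cod C t = Cod C g" "t \<cdot>\<^bsub>C\<^esub> q = g"
    using cokernel_factor[OF q, of g] kg qk by auto
  have "\<exists>!u. u \<in> Hom C W (Dom C k) \<and> k \<cdot>\<^bsub>C\<^esub> u = j"
    if j: "j \<in> Hom C W (Dom C q)" and qj: "q \<cdot>\<^bsub>C\<^esub> j = zero_arr A W (Cod C q)" for W j
  proof -
    have j': "j \<in> Arr C" "Dom C j = W" "Cod C j = Cod C k" using j qk by (auto simp: Hom_def)
    have "g \<cdot>\<^bsub>C\<^esub> j = t \<cdot>\<^bsub>C\<^esub> (q \<cdot>\<^bsub>C\<^esub> j)" using t qk j' by (metis Comp_assoc_Arr)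
    then have "g \<cdot>\<^bsub>C\<^esub> j = zero_arr A W (Cod C g)" using qj t j' Dom_in by auto
    moreover have "j \<in> Hom C W (Dom C g)" using j' kg by (simp add: Hom_def)
    ultimately show ?thesis using k unfolding is_kernel_def by blast
  qed
  then show ?thesis using q kg qk by (simp add: short_exact_def is_kernel_def)
qed

text \<open>Here \<open>q\<close> is the coimage of \<open>f\<close>, and the substance is that the
  induced arrow \<open>m\<close> is monic. It later reduces kernels of arbitrary arrows to short
  exact sequences.\<close>

lemma mono_factorization:
  assumes k: "is_kernel C A k f" and q: "is_cokernel C A q k"
  obtains m where "monomorphism C m" "Dom C m = Cod C q" "Cod C m = Cod C f" "m \<cdot>\<^bsub>C\<^esub> q = f"
proof -
  have kf: "k \<in> Arr C" "f \<in> Arr C" "Dom C f = Cod C k" "f \<cdot>\<^bsub>C\<^esub> k = zero_arr A (Dom C k) (Cod C f)"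
    using k by (auto simp: is_kernel_def)
  have qk: "q \<in> Arr C" "Dom C q = Cod C k" "q \<cdot>\<^bsub>C\<^esub> k = zero_arr A (Dom C k) (Cod C q)"
    using q by (auto simp: is_cokernel_def)
  obtain m where m: "m \<in> Arr C" "Dom C m = Cod C q" "Cod C m = Cod C f" "m \<cdot>\<^bsub>C\<^esub> q = f"
    using cokernel_factor[OF q, of f] kf qk by auto
  have "monomorphism C m"
  proof (rule monomorphismI[OF m(1)])
    fix x assume x: "x \<in> Arr C" "Cod C x = Dom C m" "m \<cdot>\<^bsub>C\<^esub> x = zero_arr A (Dom C x) (Cod C m)"
    \<comment> \<open>Since \<open>m x = 0\<close>, the arrow \<open>m\<close> factors through the
      cokernel \<open>c\<close> of \<open>x\<close>. It suffices to show that \<open>c\<close> has a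
      left inverse, because \<open>c x = 0\<close>.\<close>
    obtain c where c: "is_cokernel C A c x" using cokernel_exists x by blast
    have cx: "c \<in> Arr C" "Dom C c = Cod C x" "c \<cdot>\<^bsub>C\<^esub> x = zero_arr A (Dom C x) (Cod C c)"
      using c by (auto simp: is_cokernel_def)
    obtain n where n: "n \<in> Arr C" "Dom C n = Cod C c" "Cod C n = Cod C m" "n \<cdot>\<^bsub>C\<^esub> c = m"
      using cokernel_factor[OF c, of m] m x cx by auto
    \<comment> \<open>The epimorphism \<open>c q\<close> is a cokernel of some \<open>l\<close>; since \<open>f l = 0\<close>, also \<open>q l = 0\<close>, so \<open>q\<close> factors
      through \<open>c q\<close>, whence \<open>c\<close> is split monic, and \<open>c x = 0\<close>.\<close>
    have "epimorphism C (c \<cdot>\<^bsub>C\<^esub> q)"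
      unfolding epimorphism_def
    proof (intro conjI allI ballI impI)
      fix Z g h
      assume "g \<in> Hom C (Cod C (c \<cdot>\<^bsub>C\<^esub> q)) Z" "h \<in> Hom C (Cod C (c \<cdot>\<^bsub>C\<^esub> q)) Z"
        and eq: "g \<cdot>\<^bsub>C\<^esub> (c \<cdot>\<^bsub>C\<^esub> q) = h \<cdot>\<^bsub>C\<^esub> (c \<cdot>\<^bsub>C\<^esub> q)"
      then have gh: "g \<in> Hom C (Cod C c) Z" "h \<in> Hom C (Cod C c) Z"
        using m x qk cx by auto
      have "g \<cdot>\<^bsub>C\<^esub> c = h \<cdot>\<^bsub>C\<^esub> c"
        by (rule cokernel_cancel[OF q, of _ Z]) (use gh eq m x qk cx in \<open>auto simp: Hom_def\<close>)
      then show "g = h" using cokernel_cancel[OF c gh] by simp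
    qed (use m x qk cx in auto)
    then obtain l where l: "is_cokernel C A (c \<cdot>\<^bsub>C\<^esub> q) l" using epi_is_cokernel by blast
    then have lA: "l \<in> Arr C" "Cod C l = Dom C q"
      and cql: "c \<cdot>\<^bsub>C\<^esub> (q \<cdot>\<^bsub>C\<^esub> l) = zero_arr A (Dom C l) (Cod C c)"
      using m x qk cx by (auto simp: is_cokernel_def)
    have "f \<cdot>\<^bsub>C\<^esub> l = m \<cdot>\<^bsub>C\<^esub> (q \<cdot>\<^bsub>C\<^esub> l)"
      using Comp_assoc_Arr[of l q m] m qk lA by simp
    also have "\<dots> = n \<cdot>\<^bsub>C\<^esub> (c \<cdot>\<^bsub>C\<^esub> (q \<cdot>\<^bsub>C\<^esub> l))"
      using Comp_assoc_Arr[of "q \<cdot>\<^bsub>C\<^esub> l" c n] n m x qk cx lA by simp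
    finally have fl: "f \<cdot>\<^bsub>C\<^esub> l = n \<cdot>\<^bsub>C\<^esub> (c \<cdot>\<^bsub>C\<^esub> (q \<cdot>\<^bsub>C\<^esub> l))" .
    have "f \<cdot>\<^bsub>C\<^esub> l = zero_arr A (Dom C l) (Cod C f)" unfolding fl using cql n m lA Dom_in by simp
    then obtain l' where l': "l' \<in> Arr C" "Dom C l' = Dom C l" "Cod C l' = Dom C k" "k \<cdot>\<^bsub>C\<^esub> l' = l"
      using kernel_factor[OF k, of l] lA qk by auto
    have "q \<cdot>\<^bsub>C\<^esub> l = zero_arr A (Dom C l) (Cod C q)"
      using Comp_reduce[OF qk(3), of l'] l' qk kf Cod_in by simp
    then obtain t where t: "t \<in> Arr C" "Dom C t = Cod C c" "Cod C t = Cod C q" "t \<cdot>\<^bsub>C\<^esub> (c \<cdot>\<^bsub>C\<^esub> q) = q"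
      using cokernel_factor[OF l, of q] m x qk cx lA by auto
    have "t \<cdot>\<^bsub>C\<^esub> c = Ident C (Cod C q)"
      by (rule cokernel_cancel[OF q, of _ "Cod C q"]) (use t m x qk cx Cod_in in \<open>auto simp: Hom_def\<close>)
    from Comp_reduce[OF this, of x] have "t \<cdot>\<^bsub>C\<^esub> (c \<cdot>\<^bsub>C\<^esub> x) = x" using t m x cx by simp
    then show "x = zero_arr A (Dom C x) (Dom C m)" using cx(3) t m x Dom_in by auto
  qed
  then show thesis using that m by blast
qed

end

section \<open>Exact left adjoints\<close>

lemma additive_functor_AMap_zero:
  assumes "additive_category B AB" "additive_category C AC" "additive_functor B AB C AC F" "X \<in> Obj B" "Y \<in> Obj B"
  shows "AMap F (zero_arr AB X Y) = zero_arr AC (OMap F X) (OMap F Y)"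
proof -
  interpret AB: additive_category B AB by fact
  interpret AC: additive_category C AC by fact
  interpret F: additive_functor B AB C AC F by fact
  note z = AB.zero_Hom[OF assms(4,5)]
  show ?thesis
    using AC.idempotent_zero[OF F.AMap_in[OF z]] F.AMap_add[OF z z] AB.zero_add_zero[OF assms(4,5)] by simp
qed

lemma additive_functor_AMap_inv:
  assumes "additive_category B AB" "additive_category C AC" "additive_functor B AB C AC F" "f \<in> Hom B X Y"
  shows "AMap F (inv\<^bsub>AB X Y\<^esub> f) = inv\<^bsub>AC (OMap F X) (OMap F Y)\<^esub> (AMap F f)"
proof -
  interpret AB: additive_category B AB by fact
  interpret AC: additive_category C AC by fact
  interpret F: additive_functor B AB C AC F by fact
  note i = AB.inv_Hom[OF assms(4)]
  have "AMap F f \<otimes>\<^bsub>AC (OMap F X) (OMap F Y)\<^esub> AMap F (inv\<^bsub>AB X Y\<^esub> f) = zero_arr AC (OMap F X) (OMap F Y)"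
    using F.AMap_add[OF assms(4) i] AB.add_inv[OF assms(4)] AB.Hom_Obj[OF assms(4)]
      additive_functor_AMap_zero[OF assms(1-3), of X Y] by simp
  then show ?thesis using AC.inv_unique[OF F.AMap_in[OF assms(4)] F.AMap_in[OF i]] by simp
qed

text \<open>A monomorphism with its cokernel is short exact, so its image is again a kernel.\<close>

lemma exact_functor_preserves_mono:
  assumes "abelian_category B AB" "abelian_category C AC" "exact_functor B AB C AC F" "monomorphism B m"
  shows "monomorphism C (AMap F m)"
proof -
  interpret AB: abelian_category B AB by fact
  interpret AC: abelian_category C AC by fact
  interpret F: exact_functor B AB C AC F by fact
  obtain q where "is_cokernel B AB q m"
    using AB.cokernel_exists assms(4) unfolding monomorphism_def by blast
  then have "short_exact C AC (AMap F m) (AMap F q)"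
    using F.preserves_short_exact AB.mono_short_exact assms(4) by blast
  then show ?thesis using AC.kernel_mono by (auto simp: short_exact_def)
qed

text \<open>Exactness speaks of short exact sequences, while \<open>f\<close> need not be epic.
  Writing \<open>f = m q\<close> with \<open>q\<close> a cokernel of \<open>k\<close> and
  \<open>m\<close> monic, \<open>F m\<close> stays monic, so \<open>F f y = 0\<close> forces
  \<open>F q y = 0\<close>, and \<open>F k\<close> is a kernel of \<open>F q\<close>.\<close>

lemma exact_functor_preserves_kernel_factor:
  assumes "abelian_category B AB" "abelian_category C AC" "exact_functor B AB C AC F" and k: "is_kernel B AB k f"
    and y: "y \<in> Arr C" "Cod C y = OMap F (Dom B f)"
    and fy: "AMap F f \<cdot>\<^bsub>C\<^esub> y = zero_arr AC (Dom C y) (OMap F (Cod B f))"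
  obtains u where "u \<in> Arr C" "Dom C u = Dom C y" "Cod C u = OMap F (Dom B k)"
    "AMap F k \<cdot>\<^bsub>C\<^esub> u = y"
proof -
  interpret AB: abelian_category B AB by fact
  interpret AC: abelian_category C AC by fact
  interpret F: exact_functor B AB C AC F by fact
  have kf: "k \<in> Arr B" "f \<in> Arr B" "Dom B f = Cod B k" using k by (auto simp: is_kernel_def)
  obtain q where q: "is_cokernel B AB q k" using AB.cokernel_exists kf by blast
  have qA: "q \<in> Arr B" "Dom B q = Cod B k" using q by (auto simp: is_cokernel_def)
  obtain m where m: "monomorphism B m" "Dom B m = Cod B q" "Cod B m = Cod B f" "m \<cdot>\<^bsub>B\<^esub> q = f"
    using AB.mono_factorization[OF k q] by blast
  have mA: "m \<in> Arr B" using m by (simp add: monomorphism_def)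
  have Fm: "monomorphism C (AMap F m)" using exact_functor_preserves_mono[OF assms(1-3) m(1)] .
  have Fq: "is_kernel C AC (AMap F k) (AMap F q)"
    using F.preserves_short_exact[OF AB.mono_short_exact[OF AB.kernel_mono[OF k] q]]
    by (simp add: short_exact_def)
  have O: "Dom C y \<in> Obj C" "OMap F (Cod B q) \<in> Obj C"
    using y qA AC.Dom_in F.OMap_in AB.Cod_in by auto
  have "AMap F m \<cdot>\<^bsub>C\<^esub> (AMap F q \<cdot>\<^bsub>C\<^esub> y) = (AMap F m \<cdot>\<^bsub>C\<^esub> AMap F q) \<cdot>\<^bsub>C\<^esub> y"
    using mA m qA y kf by simp
  also have "\<dots> = AMap F m \<cdot>\<^bsub>C\<^esub> zero_arr AC (Dom C y) (OMap F (Cod B q))"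
    using fy m mA qA O F.AMap_Comp_Arr[of q m] by simp
  finally have eq: "AMap F m \<cdot>\<^bsub>C\<^esub> (AMap F q \<cdot>\<^bsub>C\<^esub> y) = AMap F m \<cdot>\<^bsub>C\<^esub> zero_arr AC (Dom C y) (OMap F (Cod B q))" .
  have "AMap F q \<cdot>\<^bsub>C\<^esub> y = zero_arr AC (Dom C y) (OMap F (Cod B q))"
    by (rule AC.mono_cancel[OF Fm _ _ _ _ eq]) (use m mA qA y kf O in auto)
  then show thesis using AC.kernel_factor[OF Fq, of y] y kf qA that by auto
qed

section \<open>Comodules over an exact left adjoint\<close>

lemma (in adjunction) conservative_eta_mono:
  assumes AB: "abelian_category B AB" and AC: "abelian_category C AC" and ex: "exact_functor B AB C AC P"
    and cons: "\<And>H. H \<in> Obj B \<Longrightarrow> zero_object C (OMap P H) \<Longrightarrow> zero_object B H"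
    and H: "H \<in> Obj B"
  shows "monomorphism B (\<eta> H)"
proof -
  interpret AB: abelian_category B AB by fact
  interpret AC: abelian_category C AC by fact
  interpret E: exact_functor B AB C AC P by fact
  note aP = additive_functor_AMap_zero[OF AB.additive_category_axioms AC.additive_category_axioms E.additive_functor_axioms]
  show ?thesis
  proof (rule AB.monomorphismI)
    fix x
    assume x: "x \<in> Arr B" "Cod B x = Dom B (\<eta> H)" and z: "\<eta> H \<cdot>\<^bsub>B\<^esub> x = zero_arr AB (Dom B x) (Cod B (\<eta> H))"
    obtain k where k: "is_kernel B AB k (\<eta> H)" using AB.kernel_exists H by (meson eta_Arr)
    then have kA: "k \<in> Arr B" "Cod B k = H" and \<eta>k: "\<eta> H \<cdot>\<^bsub>B\<^esub> k = zero_arr AB (Dom B k) (OMap Q (OMap P H))"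
      using H by (auto simp: is_kernel_def)
    note O [simp] = H B.Dom_in[OF kA(1)] P.OMap_in[OF H] Q.OMap_in[OF P.OMap_in[OF H]] P.OMap_in[OF B.Dom_in[OF kA(1)]]
      P.OMap_in[OF Q.OMap_in[OF P.OMap_in[OF H]]]
    \<comment> \<open>The counit recovers \<open>P k\<close> from \<open>P\<close> of the composite
      of \<open>k\<close> with the unit, and that composite is zero.\<close>
    have "AMap P k = \<epsilon> (OMap P H) \<cdot>\<^bsub>C\<^esub> AMap P (\<eta> H \<cdot>\<^bsub>B\<^esub> k)"
      using eps_P_eta_reduce[OF H, of "AMap P k"] kA by (simp add: P.AMap_Comp_Arr)
    also have "\<dots> = zero_arr AC (OMap P (Dom B k)) (OMap P H)"
      by (simp add: \<eta>k aP)
    finally have Pk: "AMap P k = zero_arr AC (OMap P (Dom B k)) (OMap P H)" .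
    \<comment> \<open>\<open>P k\<close> is both zero and, by exactness, monic; hence the identity
      of its source is zero.\<close>
    have "Ident C (OMap P (Dom B k)) = zero_arr AC (OMap P (Dom B k)) (OMap P (Dom B k))"
      by (rule C.mono_cancel[OF exact_functor_preserves_mono[OF AB AC ex AB.kernel_mono[OF k]]]) (use kA Pk in auto)
    then have "zero_object B (Dom B k)" using cons AC.zero_object_iff by simp
    then have id: "Ident B (Dom B k) = zero_arr AB (Dom B k) (Dom B k)"
      using AB.zero_object_iff by simp
    obtain u where u: "u \<in> Arr B" "Dom B u = Dom B x" "Cod B u = Dom B k" "k \<cdot>\<^bsub>B\<^esub> u = x"
      using AB.kernel_factor[OF k, of x] x z kA H by auto
    have "Ident B (Dom B k) \<cdot>\<^bsub>B\<^esub> u = u" using u by simp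
    then have "u = zero_arr AB (Dom B x) (Dom B k)" using u by (simp add: id)
    then show "x = zero_arr AB (Dom B x) (Dom B (\<eta> H))"
      using u(4) kA x B.Dom_in by auto
  qed (use H in simp)
qed

text \<open>Forgetting coactions reflects isomorphisms: composing the comodule square for
  \<open>u\<close> with \<open>v\<close> on one side and \<open>T v\<close> on the other yields the
  square for the inverse \<open>v\<close>.\<close>

lemma (in adjunction) comodule_iso:
  assumes X: "(X, a) \<in> comodules C (adjunction_comonad P Q \<eta> \<epsilon>)"
    and Y: "(Y, b) \<in> comodules C (adjunction_comonad P Q \<eta> \<epsilon>)"
    and u: "u \<in> Hom C X Y" and comm: "AMap P (AMap Q u) \<cdot>\<^bsub>C\<^esub> a = b \<cdot>\<^bsub>C\<^esub> u"
    and iso: "isomorphism C u"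
  shows "isomorphism (comodule_category C (adjunction_comonad P Q \<eta> \<epsilon>)) ((X, a), u, (Y, b))"
    (is "isomorphism ?CT _")
proof -
  have uA: "u \<in> Arr C" "Dom C u = X" "Cod C u = Y" using u by (auto simp: Hom_def)
  obtain v where v: "v \<in> Arr C" "Dom C v = Y" "Cod C v = X"
    and vu: "v \<cdot>\<^bsub>C\<^esub> u = Ident C X" and uv: "u \<cdot>\<^bsub>C\<^esub> v = Ident C Y"
    using C.iso_inverse[OF iso] uA by metis
  have a: "a \<in> Arr C" "Dom C a = X" "Cod C a = OMap P (OMap Q X)"
    and b: "b \<in> Arr C" "Dom C b = Y" "Cod C b = OMap P (OMap Q Y)"
    and O [simp]: "X \<in> Obj C" "Y \<in> Obj C"
    using X Y by (auto simp: comodules_iff Hom_def)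
  have "AMap P (AMap Q v) \<cdot>\<^bsub>C\<^esub> b = AMap P (AMap Q v) \<cdot>\<^bsub>C\<^esub> ((b \<cdot>\<^bsub>C\<^esub> u) \<cdot>\<^bsub>C\<^esub> v)"
    using uA v b uv by simp
  also have "\<dots> = AMap P (AMap Q (v \<cdot>\<^bsub>C\<^esub> u)) \<cdot>\<^bsub>C\<^esub> (a \<cdot>\<^bsub>C\<^esub> v)"
    unfolding comm[symmetric] using uA v a by (simp add: Q.AMap_Comp_Arr P.AMap_Comp_Arr)
  also have "\<dots> = a \<cdot>\<^bsub>C\<^esub> v" using a v by (simp add: vu AMap_PQ_Ident)
  finally have comm': "AMap P (AMap Q v) \<cdot>\<^bsub>C\<^esub> b = a \<cdot>\<^bsub>C\<^esub> v" .
  have "v \<in> Hom C Y X" using v by (simp add: Hom_def)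
  then have v_Hom: "((Y, b), v, (X, a)) \<in> Hom ?CT (Y, b) (X, a)"
    using X Y comm' unfolding Hom_comodule_category by blast
  have "((X, a), u, (Y, b)) \<in> Hom ?CT (X, a) (Y, b)"
    using X Y u comm unfolding Hom_comodule_category by blast
  then have "((X, a), u, (Y, b)) \<in> Arr ?CT" "Dom ?CT ((X, a), u, (Y, b)) = (X, a)"
    "Cod ?CT ((X, a), u, (Y, b)) = (Y, b)"
    unfolding Hom_def by simp_all
  moreover have "((Y, b), v, (X, a)) \<cdot>\<^bsub>?CT\<^esub> ((X, a), u, (Y, b)) = Ident ?CT (X, a)"
    "((X, a), u, (Y, b)) \<cdot>\<^bsub>?CT\<^esub> ((Y, b), v, (X, a)) = Ident ?CT (Y, b)"
    using vu uv by (simp_all add: comodule_category_def)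
  ultimately show ?thesis
    unfolding isomorphism_def using v_Hom by metis
qed

lemma (in adjunction) comparison_ess_surj:
  assumes AB: "abelian_category B AB" and AC: "abelian_category C AC" and ex: "exact_functor B AB C AC P"
    and Y: "(F, h) \<in> comodules C (adjunction_comonad P Q \<eta> \<epsilon>)"
  obtains E u where "E \<in> Obj B" "u \<in> Hom C (OMap P E) F" "isomorphism C u"
    "AMap P (AMap Q u) \<cdot>\<^bsub>C\<^esub> AMap P (\<eta> E) = h \<cdot>\<^bsub>C\<^esub> u"
proof -
  interpret AB: abelian_category B AB by fact
  interpret AC: abelian_category C AC by fact
  interpret E: exact_functor B AB C AC P by fact
  have F: "F \<in> Obj C" and h: "h \<in> Arr C" "Dom C h = F" "Cod C h = OMap P (OMap Q F)"
    and \<epsilon>h: "\<epsilon> F \<cdot>\<^bsub>C\<^esub> h = Ident C F"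
    and \<delta>h: "AMap P (AMap Q h) \<cdot>\<^bsub>C\<^esub> h = AMap P (\<eta> (OMap Q F)) \<cdot>\<^bsub>C\<^esub> h"
    using Y by (auto simp: comodules_iff Hom_def)
  define QF where "QF = OMap Q F"
  define QPQF where "QPQF = OMap Q (OMap P QF)"
  note O [simp] = F Q.OMap_in[OF F, folded QF_def] P.OMap_in[OF Q.OMap_in[OF F], folded QF_def]
    Q.OMap_in[OF P.OMap_in[OF Q.OMap_in[OF F]], folded QF_def, folded QPQF_def]
  note h = h[folded QF_def] note \<delta>h = \<delta>h[folded QF_def]
  have Qh: "AMap Q h \<in> Hom B QF QPQF" and \<eta>Q: "\<eta> QF \<in> Hom B QF QPQF"
    using Q.AMap_in[of h F "OMap P QF"] eta_in[of QF] h by (simp_all add: Hom_def QF_def[symmetric] QPQF_def)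
  \<comment> \<open>The kernel of this difference is the equalizer of \<open>Q h\<close> and the
    unit at \<open>Q F\<close>.\<close>
  define d where "d = AMap Q h \<otimes>\<^bsub>AB QF QPQF\<^esub> inv\<^bsub>AB QF QPQF\<^esub> \<eta> QF"
  have "d \<in> Hom B QF QPQF" unfolding d_def using AB.mult_Hom[OF Qh AB.inv_Hom[OF \<eta>Q]] .
  then have d: "d \<in> Arr B" "Dom B d = QF" "Cod B d = QPQF" by (auto simp: Hom_def)
  obtain e where k: "is_kernel B AB e d" using AB.kernel_exists d by blast
  then have e: "e \<in> Arr B" "Cod B e = QF" and de: "d \<cdot>\<^bsub>B\<^esub> e = zero_arr AB (Dom B e) QPQF"
    using d by (auto simp: is_kernel_def)
  define E where "E = Dom B e"
  have E: "E \<in> Obj B" using e B.Dom_in by (simp add: E_def)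
  note e = e E_def[symmetric]
  have eH: "e \<in> Hom B E QF" using e by (simp add: Hom_def)
  have eq: "AMap Q h \<cdot>\<^bsub>B\<^esub> e = \<eta> QF \<cdot>\<^bsub>B\<^esub> e"
    using AB.diff_eq_zero_iff[OF B.Comp_in[OF eH Qh] B.Comp_in[OF eH \<eta>Q]]
      AB.Comp_diff_left[OF eH Qh \<eta>Q] de e by (simp add: d_def)
  have \<eta>e: "\<eta> QF \<cdot>\<^bsub>B\<^esub> e = AMap Q (AMap P e) \<cdot>\<^bsub>B\<^esub> \<eta> E" using eta_natural e by simp
  have Pe: "AMap P e \<in> Arr C" "Dom C (AMap P e) = OMap P E" "Cod C (AMap P e) = OMap P QF"
    using e by auto
  \<comment> \<open>The adjunct of the kernel inclusion \<open>e\<close> from \<open>E\<close> to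
    \<open>Q F\<close>.\<close>
  define u where "u = \<epsilon> F \<cdot>\<^bsub>C\<^esub> AMap P e"
  have u: "u \<in> Arr C" "Dom C u = OMap P E" "Cod C u = F"
    using Pe by (auto simp: u_def QF_def)
  \<comment> \<open>Naturality of the counit moves \<open>h\<close> to \<open>P (Q h)\<close>; the
    equalizer equation replaces \<open>Q h\<close> by the unit, and the triangle identity cancels
    it.\<close>
  have "h \<cdot>\<^bsub>C\<^esub> u = (h \<cdot>\<^bsub>C\<^esub> \<epsilon> F) \<cdot>\<^bsub>C\<^esub> AMap P e"
    using h Pe by (simp add: u_def QF_def)
  also have "h \<cdot>\<^bsub>C\<^esub> \<epsilon> F = \<epsilon> (OMap P QF) \<cdot>\<^bsub>C\<^esub> AMap P (AMap Q h)"
    using eps_natural[of h F "OMap P QF"] h by simp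
  also have "(\<epsilon> (OMap P QF) \<cdot>\<^bsub>C\<^esub> AMap P (AMap Q h)) \<cdot>\<^bsub>C\<^esub> AMap P e
      = \<epsilon> (OMap P QF) \<cdot>\<^bsub>C\<^esub> AMap P (AMap Q h \<cdot>\<^bsub>B\<^esub> e)"
    using h e by (simp add: P.AMap_Comp_Arr QF_def[symmetric])
  also have "\<dots> = AMap P e"
    unfolding eq using eps_P_eta_reduce[of QF "AMap P e"] e by (simp add: P.AMap_Comp_Arr)
  finally have hu: "h \<cdot>\<^bsub>C\<^esub> u = AMap P e" .
  \<comment> \<open>Taking the adjunct of \<open>u\<close> returns \<open>e\<close>; applying
    \<open>P\<close> and using \<open>hu\<close> then gives the comodule square for
    \<open>u\<close>.\<close>
  have "AMap Q u \<cdot>\<^bsub>B\<^esub> \<eta> E = AMap Q (\<epsilon> F) \<cdot>\<^bsub>B\<^esub> (\<eta> QF \<cdot>\<^bsub>B\<^esub> e)"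
    unfolding \<eta>e using e E by (simp add: u_def Q.AMap_Comp_Arr QF_def)
  also have "\<dots> = e"
    using B.Comp_reduce[OF triangle_right[OF F], of e] e by (simp add: QF_def[symmetric])
  finally have "AMap Q u \<cdot>\<^bsub>B\<^esub> \<eta> E = e" .
  then have comm: "AMap P (AMap Q u) \<cdot>\<^bsub>C\<^esub> AMap P (\<eta> E) = h \<cdot>\<^bsub>C\<^esub> u"
    using hu P.AMap_Comp_Arr[of "\<eta> E" "AMap Q u"] u E by simp
  have Ph: "AMap P (AMap Q h) \<in> Hom C (OMap P QF) (OMap P QPQF)"
    and P\<eta>: "AMap P (\<eta> QF) \<in> Hom C (OMap P QF) (OMap P QPQF)"
    using P.AMap_in Qh \<eta>Q by auto
  have hH: "h \<in> Hom C F (OMap P QF)" using h by (simp add: Hom_def)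
  have Pd: "AMap P d = AMap P (AMap Q h) \<otimes>\<^bsub>AC (OMap P QF) (OMap P QPQF)\<^esub> inv\<^bsub>AC (OMap P QF) (OMap P QPQF)\<^esub> AMap P (\<eta> QF)"
    unfolding d_def
    using E.AMap_add[OF Qh AB.inv_Hom[OF \<eta>Q]]
      additive_functor_AMap_inv[OF AB.additive_category_axioms AC.additive_category_axioms
        E.additive_functor_axioms \<eta>Q]
    by simp
  \<comment> \<open>Coassociativity of the coaction says precisely that \<open>P d\<close>
    annihilates \<open>h\<close>, so \<open>h\<close> factors through \<open>P e\<close>.\<close>
  have "AMap P d \<cdot>\<^bsub>C\<^esub> h = zero_arr AC F (OMap P QPQF)"
    unfolding Pd
    using AC.Comp_diff_left[OF hH Ph P\<eta>] AC.diff_eq_zero_iff[OF C.Comp_in[OF hH Ph] C.Comp_in[OF hH P\<eta>]] \<delta>h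
    by simp
  then obtain v where v: "v \<in> Arr C" "Dom C v = F" "Cod C v = OMap P E" and ev: "AMap P e \<cdot>\<^bsub>C\<^esub> v = h"
    using exact_functor_preserves_kernel_factor[OF AB AC ex k, of h] h d e by auto
  have uv: "u \<cdot>\<^bsub>C\<^esub> v = Ident C F"
    using v Pe ev \<epsilon>h C.Comp_assoc_Arr[of v "AMap P e" "\<epsilon> F"] by (simp add: u_def QF_def)
  \<comment> \<open>The remaining inverse law is tested after \<open>P e\<close>, which is monic by
    exactness.\<close>
  have "AMap P e \<cdot>\<^bsub>C\<^esub> (v \<cdot>\<^bsub>C\<^esub> u) = h \<cdot>\<^bsub>C\<^esub> u"
    using C.Comp_reduce[OF ev, of u] v u Pe by simp
  then have eqv: "AMap P e \<cdot>\<^bsub>C\<^esub> (v \<cdot>\<^bsub>C\<^esub> u) = AMap P e \<cdot>\<^bsub>C\<^esub> Ident C (OMap P E)"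
    using hu Pe P.OMap_in[OF E] by simp
  have vu: "v \<cdot>\<^bsub>C\<^esub> u = Ident C (OMap P E)"
    by (rule C.mono_cancel[OF exact_functor_preserves_mono[OF AB AC ex AB.kernel_mono[OF k]] _ _ _ _ eqv])
      (use u v Pe P.OMap_in[OF E] in auto)
  have "isomorphism C u" unfolding isomorphism_def using u v uv vu by (auto simp: Hom_def)
  then show thesis using that[OF E _ _ comm] u by (simp add: Hom_def)
qed

lemma (in adjunction) comparison_equivalence:
  assumes "abelian_category B AB" "abelian_category C AC" "exact_functor B AB C AC P"
    and ff: "fully_faithful B (comodule_category C (adjunction_comonad P Q \<eta> \<epsilon>)) (comparison_functor B P \<eta>)"
  shows "equivalence_of_categories B (comodule_category C (adjunction_comonad P Q \<eta> \<epsilon>)) (comparison_functor B P \<eta>)"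
proof (rule fully_faithful_ess_surj_equivalence[OF ff])
  interpret \<Phi>: cfunctor B "comodule_category C (adjunction_comonad P Q \<eta> \<epsilon>)" "comparison_functor B P \<eta>"
    by (rule cfunctor_comparison)
  fix Y assume "Y \<in> Obj (comodule_category C (adjunction_comonad P Q \<eta> \<epsilon>))"
  then obtain F h where Y: "Y = (F, h)" and Fh: "(F, h) \<in> comodules C (adjunction_comonad P Q \<eta> \<epsilon>)"
    by (cases Y) (simp add: comodule_category_def)
  obtain E u where E: "E \<in> Obj B" and u: "u \<in> Hom C (OMap P E) F" and iso: "isomorphism C u"
    and comm: "AMap P (AMap Q u) \<cdot>\<^bsub>C\<^esub> AMap P (\<eta> E) = h \<cdot>\<^bsub>C\<^esub> u"
    using comparison_ess_surj[OF assms(1-3) Fh] by blast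
  have \<Phi>E: "OMap (comparison_functor B P \<eta>) E = (OMap P E, AMap P (\<eta> E))"
    by (simp add: comparison_functor_def)
  then have cE: "(OMap P E, AMap P (\<eta> E)) \<in> comodules C (adjunction_comonad P Q \<eta> \<epsilon>)"
    using \<Phi>.OMap_in[OF E] by (simp add: comodule_category_def)
  have "((OMap P E, AMap P (\<eta> E)), u, Y) \<in> Hom (comodule_category C (adjunction_comonad P Q \<eta> \<epsilon>))
      (OMap (comparison_functor B P \<eta>) E) Y"
    using cE Fh u comm unfolding Y \<Phi>E Hom_comodule_category by blast
  then show "\<exists>X \<in> Obj B. \<exists>u \<in> Hom (comodule_category C (adjunction_comonad P Q \<eta> \<epsilon>))
      (OMap (comparison_functor B P \<eta>) X) Y. isomorphism (comodule_category C (adjunction_comonad P Q \<eta> \<epsilon>)) u"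
    using E comodule_iso[OF cE Fh u comm iso] unfolding Y by blast
qed

text \<open>If \<open>P H\<close> is a zero object, the identity and the zero arrow of
  \<open>H\<close> have the same image under \<open>P\<close>, so faithfulness makes them
  equal.\<close>

lemma (in adjunction) comparison_fully_faithful_conservative:
  assumes "additive_category B AB" "additive_category C AC"
    and ff: "fully_faithful B (comodule_category C (adjunction_comonad P Q \<eta> \<epsilon>)) (comparison_functor B P \<eta>)"
    and H: "H \<in> Obj B" and z: "zero_object C (OMap P H)"
  shows "zero_object B H"
proof -
  interpret AB: additive_category B AB by fact
  have I: "Ident B H \<in> Hom B H H" "zero_arr AB H H \<in> Hom B H H"
    using H B.Ident_in AB.zero_Hom by auto
  have "AMap P (Ident B H) = AMap P (zero_arr AB H H)"
    using z P.AMap_in[OF I(1)] P.AMap_in[OF I(2)] P.OMap_in[OF H] unfolding zero_object_def by blast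
  then have "Ident B H = zero_arr AB H H"
    by - (rule fully_faithful_inj[OF ff], use H in \<open>simp_all add: comparison_functor_def\<close>)
  then show ?thesis using AB.zero_object_iff[OF H] by simp
qed

section \<open>Monomorphisms in triangulated categories split\<close>

context triangulated_category
begin

sublocale S: additive_functor C A C A "Shift D"
  by (rule shift_additive)

lemma shift_zero:
  "X \<in> Obj C \<Longrightarrow> Y \<in> Obj C \<Longrightarrow>
    AMap (Shift D) (zero_arr A X Y) = zero_arr A (OMap (Shift D) X) (OMap (Shift D) Y)"
  by (rule additive_functor_AMap_zero) unfold_locales

text \<open>This allows the shift of a zero object as third vertex of an identity triangle, as
  backward rotation requires.\<close>

lemma zero_object_shift:
  assumes "zero_object C Z"
  shows "zero_object C (OMap (Shift D) Z)"
proof -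
  have Z: "Z \<in> Obj C" using assms by (simp add: zero_object_def)
  then have "Ident C Z = zero_arr A Z Z" using assms zero_object_iff by simp
  then show ?thesis
    using zero_object_iff[OF S.OMap_in[OF Z]] S.AMap_Ident[OF Z] shift_zero[OF Z Z] by simp
qed

lemma DistD:
  assumes "(f, g, h) \<in> Dist D"
  shows "f \<in> Arr C" "g \<in> Arr C" "h \<in> Arr C" "Dom C g = Cod C f" "Dom C h = Cod C g"
    "Cod C h = OMap (Shift D) (Dom C f)"
  using Dist_triangle[OF assms] by (auto simp: triangle_def)

lemma Dist_rotated:
  "(f, g, h) \<in> Dist D \<Longrightarrow>
    (g, h, inv\<^bsub>A (OMap (Shift D) (Dom C f)) (OMap (Shift D) (Cod C f))\<^esub> (AMap (Shift D) f)) \<in> Dist D"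
  using Dist_rotate Dist_triangle by blast

text \<open>The identity triangle on the source of \<open>f\<close> maps to the given one by the
  identity and \<open>f\<close>. The third component starts at a zero object, so \<open>g f\<close>
  factors through zero.\<close>

lemma Dist_Comp_zero:
  assumes t: "(f, g, h) \<in> Dist D"
  shows "g \<cdot>\<^bsub>C\<^esub> f = zero_arr A (Dom C f) (Cod C g)"
proof -
  note [simp] = DistD[OF t]
  obtain Z where z: "zero_object C Z" using zero_object_exists by blast
  have [simp]: "Z \<in> Obj C" using z by (simp add: zero_object_def)
  have [simp]: "Dom C f \<in> Obj C" "Cod C f \<in> Obj C" "Cod C g \<in> Obj C"
    using Dom_in Cod_in by simp_all
  note [simp] = S.OMap_in
  obtain c where "triangle_morphism C (Shift D)
      (Ident C (Dom C f), zero_arr A (Dom C f) Z, zero_arr A Z (OMap (Shift D) (Dom C f))) (f, g, h)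
      (Ident C (Dom C f)) f c"
    using Dist_fill[OF Dist_Ident[OF _ z] t, of "Dom C f" "Ident C (Dom C f)" f] by (auto simp: Hom_def)
  then have "c \<in> Arr C" "Dom C c = Z" "Cod C c = Cod C g" "c \<cdot>\<^bsub>C\<^esub> zero_arr A (Dom C f) Z = g \<cdot>\<^bsub>C\<^esub> f"
    by (auto simp: triangle_morphism_def Hom_def)
  then show ?thesis using Comp_zero[of c Z "Dom C f"] by simp
qed

text \<open>Two rotations give \<open>S f\<close> after \<open>h\<close> equal to zero. Full
  faithfulness and essential surjectivity of the shift \<open>S\<close> move this relation back to
  \<open>f\<close>, where monicity applies.\<close>

lemma mono_Dist_zero:
  assumes m: "monomorphism C f" and t: "(f, g, h) \<in> Dist D"
  shows "h = zero_arr A (Cod C g) (OMap (Shift D) (Dom C f))"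
proof -
  note T = DistD[OF t]
  note ff = equivalence_fully_faithful[OF shift_equivalence]
  have O [simp]: "Dom C f \<in> Obj C" "Cod C f \<in> Obj C" "Cod C g \<in> Obj C"
    using T Dom_in Cod_in by simp_all
  note SO [simp] = S.OMap_in
  have Sf: "AMap (Shift D) f \<in> Hom C (OMap (Shift D) (Dom C f)) (OMap (Shift D) (Cod C f))"
    using T by (simp add: Hom_def)
  have hH: "h \<in> Hom C (Cod C g) (OMap (Shift D) (Dom C f))" using T by (simp add: Hom_def)
  have "inv\<^bsub>A (OMap (Shift D) (Dom C f)) (OMap (Shift D) (Cod C f))\<^esub> (AMap (Shift D) f) \<cdot>\<^bsub>C\<^esub> h
      = zero_arr A (Cod C g) (OMap (Shift D) (Cod C f))"
    using Dist_Comp_zero[OF Dist_rotated[OF Dist_rotated[OF t]]] inv_Hom[OF Sf] T by (auto simp: Hom_def)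
  then have "inv\<^bsub>A (Cod C g) (OMap (Shift D) (Cod C f))\<^esub> (AMap (Shift D) f \<cdot>\<^bsub>C\<^esub> h)
      = zero_arr A (Cod C g) (OMap (Shift D) (Cod C f))"
    using inv_Comp[OF hH Sf] by simp
  then have Sfh: "AMap (Shift D) f \<cdot>\<^bsub>C\<^esub> h = zero_arr A (Cod C g) (OMap (Shift D) (Cod C f))"
    using inv_inv_Hom[OF Comp_in[OF hH Sf]] inv_zero[of "Cod C g" "OMap (Shift D) (Cod C f)"] by simp
  \<comment> \<open>Replacing the source of \<open>h\<close> by an isomorphic shift
    \<open>S W\<close> makes \<open>h t\<close> an arrow between shifts, hence of the form
    \<open>S h'\<close>.\<close>
  obtain W t where W: "W \<in> Obj C" and "t \<in> Hom C (OMap (Shift D) W) (Cod C g)" and ti: "isomorphism C t"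
    using equivalence_ess_surj[OF shift_equivalence O(3)] by blast
  then have tA: "t \<in> Arr C" "Dom C t = OMap (Shift D) W" "Cod C t = Cod C g" by (auto simp: Hom_def)
  have "h \<cdot>\<^bsub>C\<^esub> t \<in> Hom C (OMap (Shift D) W) (OMap (Shift D) (Dom C f))"
    using T tA by (simp add: Hom_def)
  then obtain h' where "h' \<in> Hom C W (Dom C f)" and Sh': "AMap (Shift D) h' = h \<cdot>\<^bsub>C\<^esub> t"
    using fully_faithful_surj[OF ff W O(1)] by blast
  then have h': "h' \<in> Arr C" "Dom C h' = W" "Cod C h' = Dom C f" by (auto simp: Hom_def)
  have "AMap (Shift D) (f \<cdot>\<^bsub>C\<^esub> h') = (AMap (Shift D) f \<cdot>\<^bsub>C\<^esub> h) \<cdot>\<^bsub>C\<^esub> t"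
    using T tA h' by (simp add: S.AMap_Comp_Arr Sh')
  also have "\<dots> = AMap (Shift D) (zero_arr A W (Cod C f))"
    unfolding Sfh using tA W by (simp add: shift_zero)
  finally have S_eq: "AMap (Shift D) (f \<cdot>\<^bsub>C\<^esub> h') = AMap (Shift D) (zero_arr A W (Cod C f))" .
  have "f \<cdot>\<^bsub>C\<^esub> h' = zero_arr A W (Cod C f)"
    by (rule fully_faithful_inj[OF ff _ _ _ _ S_eq]) (use T h' W in simp_all)
  then have fh': "f \<cdot>\<^bsub>C\<^esub> h' = f \<cdot>\<^bsub>C\<^esub> zero_arr A W (Dom C f)" using T W by simp
  have "h' = zero_arr A W (Dom C f)"
    by (rule mono_cancel[OF m _ _ _ _ fh']) (use h' W in simp_all)
  then have ht: "h \<cdot>\<^bsub>C\<^esub> t = zero_arr A (Cod C g) (OMap (Shift D) (Dom C f)) \<cdot>\<^bsub>C\<^esub> t"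
    using Sh' shift_zero[OF W O(1)] tA by simp
  show ?thesis by (rule iso_cancel_right[OF ti _ _ _ _ ht]) (use T tA in simp_all)
qed

text \<open>The third arrow of a triangle on a monomorphism vanishes, which lets the identity of
  \<open>S X\<close> extend along \<open>S f\<close> up to sign. Full faithfulness of
  \<open>S\<close> turns the extension into a left inverse of \<open>f\<close>.\<close>

lemma mono_split_embedding:
  assumes m: "monomorphism C f"
  shows "split_embedding C f"
proof -
  let ?S = "OMap (Shift D)" and ?Sa = "AMap (Shift D)"
  have "f \<in> Arr C" using m by (simp add: monomorphism_def)
  then obtain g h where t: "(f, g, h) \<in> Dist D" using Dist_cone by blast
  note T = DistD[OF t]
  define X where "X = Dom C f"
  define Y where "Y = Cod C f"
  define Z where "Z = Cod C g"
  have O [simp]: "X \<in> Obj C" "Y \<in> Obj C" "Z \<in> Obj C"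
    using T Dom_in Cod_in by (auto simp: X_def Y_def Z_def)
  note T = T[folded X_def Y_def Z_def] X_def[symmetric] Y_def[symmetric] Z_def[symmetric]
  note SO [simp] = S.OMap_in
  have h: "h = zero_arr A Z (?S X)" using mono_Dist_zero[OF m t] by (simp add: X_def Z_def)
  have Sf: "?Sa f \<in> Hom C (?S X) (?S Y)" using T by (simp add: Hom_def)
  have mSf: "inv\<^bsub>A (?S X) (?S Y)\<^esub> (?Sa f) \<in> Hom C (?S X) (?S Y)" using inv_Hom[OF Sf] .
  obtain k where t2: "(h, inv\<^bsub>A (?S X) (?S Y)\<^esub> (?Sa f), k) \<in> Dist D"
    using Dist_rotated[OF Dist_rotated[OF t]] by (auto simp: X_def Y_def)
  note T2 = DistD[OF t2]
  obtain N where z: "zero_object C N" using zero_object_exists by blast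
  have N [simp]: "N \<in> Obj C" using z by (simp add: zero_object_def)
  \<comment> \<open>The third vertex is \<open>S N\<close> so that this identity triangle is the
    rotation of one starting at \<open>N\<close>; the sign in the rotation acts on a zero
    arrow.\<close>
  have "(Ident C (?S X), zero_arr A (?S X) (?S N), zero_arr A (?S N) (?S (?S X))) \<in> Dist D"
    by (rule Dist_Ident) (use zero_object_shift[OF z] in auto)
  moreover have "triangle C (Shift D) (zero_arr A N (?S X), Ident C (?S X), zero_arr A (?S X) (?S N))"
    by (simp add: triangle_def)
  ultimately have t3: "(zero_arr A N (?S X), Ident C (?S X), zero_arr A (?S X) (?S N)) \<in> Dist D"
    using Dist_rotate[of "zero_arr A N (?S X)" "Ident C (?S X)" "zero_arr A (?S X) (?S N)"]
    by (simp add: shift_zero inv_zero)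
  \<comment> \<open>Since \<open>h = 0\<close>, the square from \<open>h\<close> to \<open>N \<rightarrow> S X\<close> with the identity of \<open>S X\<close> on the right commutes;
    its completion is a left inverse of \<open>- S f\<close>.\<close>
  have "\<exists>c. triangle_morphism C (Shift D) (h, inv\<^bsub>A (?S X) (?S Y)\<^esub> (?Sa f), k)
      (zero_arr A N (?S X), Ident C (?S X), zero_arr A (?S X) (?S N)) (zero_arr A Z N) (Ident C (?S X)) c"
    by (rule Dist_fill[OF t2 t3]) (simp_all add: h Hom_def)
  then obtain c where "c \<in> Hom C (Dom C k) (?S X)"
    and ceq: "c \<cdot>\<^bsub>C\<^esub> inv\<^bsub>A (?S X) (?S Y)\<^esub> (?Sa f) = Ident C (?S X) \<cdot>\<^bsub>C\<^esub> Ident C (?S X)"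
    by (auto simp: triangle_morphism_def)
  moreover have "Dom C k = ?S Y" using T2 mSf by (auto simp: Hom_def)
  ultimately have c: "c \<in> Hom C (?S Y) (?S X)" by simp
  \<comment> \<open>The sign moves across the composition, from \<open>S f\<close> to
    \<open>c\<close>.\<close>
  have "inv\<^bsub>A (?S Y) (?S X)\<^esub> c \<cdot>\<^bsub>C\<^esub> ?Sa f = c \<cdot>\<^bsub>C\<^esub> inv\<^bsub>A (?S X) (?S Y)\<^esub> (?Sa f)"
    using inv_Comp[OF Sf c] Comp_inv[OF Sf c] by simp
  also have "\<dots> = Ident C (?S X)" unfolding ceq by simp
  finally have cSf: "inv\<^bsub>A (?S Y) (?S X)\<^esub> c \<cdot>\<^bsub>C\<^esub> ?Sa f = Ident C (?S X)" .
  note ff = equivalence_fully_faithful[OF shift_equivalence]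
  obtain r where "r \<in> Hom C Y X" and Sr: "?Sa r = inv\<^bsub>A (?S Y) (?S X)\<^esub> c"
    using fully_faithful_surj[OF ff O(2,1) inv_Hom[OF c]] by blast
  then have r: "r \<in> Arr C" "Dom C r = Y" "Cod C r = X" by (auto simp: Hom_def)
  have S_eq: "?Sa (r \<cdot>\<^bsub>C\<^esub> f) = ?Sa (Ident C X)"
    using T r cSf by (simp add: S.AMap_Comp_Arr Sr S.AMap_Ident)
  have "r \<cdot>\<^bsub>C\<^esub> f = Ident C X"
    by (rule fully_faithful_inj[OF ff _ _ _ _ S_eq]) (use T r in simp_all)
  then show ?thesis
    unfolding split_embedding_def using T r by (auto simp: Hom_def)
qed

end

section \<open>Assembly of the criteria\<close>

theorem corollary3p10:
  fixes B :: "('b, 'p) category" and C :: "('c, 'q) category"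
    and P :: "('b, 'p, 'c, 'q) cfunctor" and Q :: "('c, 'q, 'b, 'p) cfunctor"
    and \<eta> :: "'b \<Rightarrow> 'p" and \<epsilon> :: "'c \<Rightarrow> 'q"
  defines "CT \<equiv> comodule_category C (adjunction_comonad P Q \<eta> \<epsilon>)"
    and "\<Phi> \<equiv> comparison_functor B P \<eta>"
  assumes "adjunction B C P Q \<eta> \<epsilon>"
  shows
    "(\<forall>AB AC. abelian_category B AB \<and> abelian_category C AC \<longrightarrow>
        (fully_faithful B CT \<Phi> \<longleftrightarrow> (\<forall>H \<in> Obj B. monomorphism B (\<eta> H))) \<and>
        (exact_functor B AB C AC P \<longrightarrow>
          (fully_faithful B CT \<Phi> \<longleftrightarrow> equivalence_of_categories B CT \<Phi>) \<and>
          (equivalence_of_categories B CT \<Phi> \<longleftrightarrow>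
            (\<forall>H \<in> Obj B. \<not> zero_object B H \<longrightarrow> \<not> zero_object C (OMap P H))))) \<and>
     (\<forall>AB AC DB DC. triangulated_category B AB DB \<and> triangulated_category C AC DC \<longrightarrow>
        (fully_faithful B CT \<Phi> \<longleftrightarrow> (\<forall>H \<in> Obj B. split_embedding B (\<eta> H))))"
proof -
  interpret adjunction B C P Q \<eta> \<epsilon> by fact
  note mono = comparison_fully_faithful_eta_mono[folded CT_def \<Phi>_def]
    and ff = eta_regular_mono_comparison_fully_faithful[folded CT_def \<Phi>_def]
  show ?thesis
  proof (intro conjI allI impI; elim conjE)
    fix AB AC
    assume AB: "abelian_category B AB" and AC: "abelian_category C AC"
    interpret AB: abelian_category B AB by fact
    interpret AC: abelian_category C AC by fact
    show iff: "fully_faithful B CT \<Phi> \<longleftrightarrow> (\<forall>H \<in> Obj B. monomorphism B (\<eta> H))"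
      using mono ff AB.mono_regular_mono by blast
    assume ex: "exact_functor B AB C AC P"
    show "fully_faithful B CT \<Phi> \<longleftrightarrow> equivalence_of_categories B CT \<Phi>"
      using comparison_equivalence[OF AB AC ex, folded CT_def \<Phi>_def] equivalence_fully_faithful by blast
    \<comment> \<open>A conservative exact \<open>P\<close> has monic units, and these give full
      faithfulness by the first criterion; conversely, full faithfulness makes \<open>P\<close>
      detect zero objects.\<close>
    moreover have "fully_faithful B CT \<Phi> \<longleftrightarrow> (\<forall>H \<in> Obj B. \<not> zero_object B H \<longrightarrow> \<not> zero_object C (OMap P H))"
      using iff conservative_eta_mono[OF AB AC ex]
        comparison_fully_faithful_conservative[OF AB.additive_category_axioms AC.additive_category_axioms,
          folded CT_def \<Phi>_def]
      by blast
    ultimately show "equivalence_of_categories B CT \<Phi> \<longleftrightarrow>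
        (\<forall>H \<in> Obj B. \<not> zero_object B H \<longrightarrow> \<not> zero_object C (OMap P H))" by blast
  next
    fix AB AC DB DC
    assume TB: "triangulated_category B AB DB"
    interpret TB: triangulated_category B AB DB by fact
    show "fully_faithful B CT \<Phi> \<longleftrightarrow> (\<forall>H \<in> Obj B. split_embedding B (\<eta> H))"
    proof
      assume "fully_faithful B CT \<Phi>"
      then show "\<forall>H \<in> Obj B. split_embedding B (\<eta> H)"
        by (intro ballI TB.mono_split_embedding mono)
    next
      assume "\<forall>H \<in> Obj B. split_embedding B (\<eta> H)"
      then show "fully_faithful B CT \<Phi>"
        by (intro ff B.split_embedding_regular_mono) simp
    qed
  qed
qed

end
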